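(* Let $\{X_t:t\ge0\}$ be an irreducible continuous-time Markov process on a finite state space $E$ with jump rates $r(x,y)$ and stationary measure $\mu$. For any disjoint and non-empty sets $A,B\subset E$, $$\mathrm{cap}(A,B)\;=\;\inf_f\,\inf_\varphi\,\Vert\Phi_f-\varphi\Vert^2,$$ where the first infimum is over all functions $f:E\to\mathbb R$ which are equal to $1$ on $A$ and to $0$ on $B$, and the second infimum is over all flows $\varphi\in\mathcal F$ such that $$(\mathrm{div}\,\varphi)(x)=0\ \text{ for } x\in(A\cup B)^c,\qquad \sum_{a\in A}(\mathrm{div}\,\varphi)(a)=0,\qquad \sum_{b\in B}(\mathrm{div}\,\varphi)(b)=0.$$
   Context: $X_t$ has holding rates $\lambda(x)$, jump rates $r(x,y)$ ($x\ne y$), and law $\mathbb P_x$ when started at $x$; $\mu$ is its stationary measure (unique up to a multiplicative constant) and $M(x)=\mu(x)\lambda(x)$. With $T_A^+=\inf\{t>0: X_t\in A,\ X_s\ne X_0\text{ for some }0<s<t\}$, the capacity of disjoint $A,B$ is $\mathrm{cap}(A,B)=\sum_{x\in A}M(x)\mathbb P_x[T_A^+>T_B^+]$. Conductances: for $x\ne y$, $c(x,y)=\mu(x)r(x,y)$, $c^*(x,y)=c(y,x)$, $c_s(x,y)=\frac12\{c(x,y)+c^*(x,y)\}$. Arcs: $\mathcal E=\{(x,y)\in E\times E: x\neq y,\ c_s(x,y)>0\}$. A flow is an antisymmetric function $\varphi:\mathcal E\to\mathbb R$, i.e. $\varphi(x,y)=-\varphi(y,x)$. $\mathcal F$ is the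 space of flows with scalar product $$\langle\varphi,\psi\rangle=\frac12\sum_{(x,y)\in\mathcal E}\frac{1}{c_s(x,y)}\varphi(x,y)\psi(x,y)$$ and associated norm $\Vert\cdot\Vert$. Divergence: $(\mathrm{div}\,\varphi)(x)=\sum_{y:(x,y)\in\mathcal E}\varphi(x,y)$. For $f:E\to\mathbb R$, $\Phi_f$ is the flow $\Phi_f(x,y)=f(x)c(x,y)-f(y)c(y,x)$. *)

theory Defs
  imports "HOL-Probability.Probability"
begin

section \<open>Continuous-time Markov processes on a finite state space\<close>

text \<open>
  The state space is the finite type \<open>'e\<close>. The law \<open>P x\<close> of the process started at \<open>x\<close> is a
  measure on a sample space \<open>'w\<close>, which may but need not be path space, and \<open>X t\<close> is the position
  at time \<open>t \<ge> 0\<close>. Only the values \<open>r x y\<close> with \<open>x \<noteq> y\<close> are meaningful; \<open>r x x\<close> is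
  arbitrary and does not affect the process, the capacity, the arcs or the flows.
\<close>

definition markov_process ::
  "('e::finite \<Rightarrow> 'w measure) \<Rightarrow> (real \<Rightarrow> 'w \<Rightarrow> 'e) \<Rightarrow> bool" where
  "markov_process P X \<longleftrightarrow>
     (\<forall>x. prob_space (P x)) \<and>
     (\<forall>x. \<forall>t\<ge>0. X t \<in> measurable (P x) (count_space UNIV)) \<and>
     \<comment> \<open>right-continuity of paths, for the discrete topology on the state space\<close>
     (\<forall>x. \<forall>\<omega>\<in>space (P x). \<forall>t\<ge>0. \<exists>\<epsilon>>0. \<forall>s\<in>{t..<t + \<epsilon>}. X s \<omega> = X t \<omega>) \<and>
     (\<forall>x. AE \<omega> in P x. X 0 \<omega> = x) \<and>
     \<comment> \<open>time-homogeneous Markov property, for finitely many times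
         \<open>0 \<le> \<tau> 0 \<le> \<dots> \<le> \<tau> (Suc n)\<close>\<close>
     (\<forall>x n \<tau> z. 0 \<le> \<tau> 0 \<and> (\<forall>i\<le>n. \<tau> i \<le> \<tau> (Suc i)) \<longrightarrow>
        \<P>(\<omega> in P x. \<forall>i\<le>Suc n. X (\<tau> i) \<omega> = z i) =
        \<P>(\<omega> in P x. \<forall>i\<le>n. X (\<tau> i) \<omega> = z i) *
        \<P>(\<omega> in P (z n). X (\<tau> (Suc n) - \<tau> n) \<omega> = z (Suc n)))"

definition has_jump_rates ::
  "('e::finite \<Rightarrow> 'w measure) \<Rightarrow> (real \<Rightarrow> 'w \<Rightarrow> 'e) \<Rightarrow> ('e \<Rightarrow> 'e \<Rightarrow> real) \<Rightarrow> bool" where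
  "has_jump_rates P X r \<longleftrightarrow>
     (\<forall>x y. x \<noteq> y \<longrightarrow> ((\<lambda>t. \<P>(\<omega> in P x. X t \<omega> = y) / t) \<longlongrightarrow> r x y) (at_right 0))"

definition irreducible_rates :: "('e::finite \<Rightarrow> 'e \<Rightarrow> real) \<Rightarrow> bool" where
  "irreducible_rates r \<longleftrightarrow> (\<forall>x y. (x, y) \<in> {(u, v). u \<noteq> v \<and> r u v > 0}\<^sup>*)"

definition stationary_measure ::
  "('e::finite \<Rightarrow> 'w measure) \<Rightarrow> (real \<Rightarrow> 'w \<Rightarrow> 'e) \<Rightarrow> ('e \<Rightarrow> real) \<Rightarrow> bool" where
  "stationary_measure P X \<mu> \<longleftrightarrow>
     (\<forall>x. \<mu> x \<ge> 0) \<and> (\<exists>x. \<mu> x \<noteq> 0) \<and>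
     (\<forall>t\<ge>0. \<forall>y. (\<Sum>x\<in>UNIV. \<mu> x * \<P>(\<omega> in P x. X t \<omega> = y)) = \<mu> y)"

definition holding_rate :: "('e::finite \<Rightarrow> 'e \<Rightarrow> real) \<Rightarrow> 'e \<Rightarrow> real" where
  "holding_rate r x = (\<Sum>y\<in>UNIV - {x}. r x y)"


section \<open>Capacity\<close>

text \<open>The infimum is taken in the extended reals, so it is \<open>\<infinity>\<close> if the set is never hit.\<close>

definition return_time :: "(real \<Rightarrow> 'w \<Rightarrow> 'e) \<Rightarrow> 'e set \<Rightarrow> 'w \<Rightarrow> ereal" where
  "return_time X A \<omega> =
     Inf (ereal ` {t. t > 0 \<and> X t \<omega> \<in> A \<and> (\<exists>s. 0 < s \<and> s < t \<and> X s \<omega> \<noteq> X 0 \<omega>)})"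

definition capacity ::
  "('e::finite \<Rightarrow> 'w measure) \<Rightarrow> (real \<Rightarrow> 'w \<Rightarrow> 'e) \<Rightarrow> ('e \<Rightarrow> 'e \<Rightarrow> real) \<Rightarrow> ('e \<Rightarrow> real) \<Rightarrow>
   'e set \<Rightarrow> 'e set \<Rightarrow> real" where
  "capacity P X r \<mu> A B =
     (\<Sum>x\<in>A. \<mu> x * holding_rate r x *
        \<P>(\<omega> in P x. return_time X A \<omega> > return_time X B \<omega>))"


section \<open>Conductances and flows\<close>

definition conductance :: "('e \<Rightarrow> 'e \<Rightarrow> real) \<Rightarrow> ('e \<Rightarrow> real) \<Rightarrow> 'e \<Rightarrow> 'e \<Rightarrow> real" where
  "conductance r \<mu> x y = \<mu> x * r x y"

definition sym_conductance :: "('e \<Rightarrow> 'e \<Rightarrow> real) \<Rightarrow> ('e \<Rightarrow> real) \<Rightarrow> 'e \<Rightarrow> 'e \<Rightarrow> real" where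
  "sym_conductance r \<mu> x y = (conductance r \<mu> x y + conductance r \<mu> y x) / 2"

definition arcs :: "('e \<Rightarrow> 'e \<Rightarrow> real) \<Rightarrow> ('e \<Rightarrow> real) \<Rightarrow> ('e \<times> 'e) set" where
  "arcs r \<mu> = {(x, y). x \<noteq> y \<and> sym_conductance r \<mu> x y > 0}"

text \<open>Functions on the arcs are represented by functions on all pairs vanishing off the arcs.\<close>

definition flows :: "('e \<Rightarrow> 'e \<Rightarrow> real) \<Rightarrow> ('e \<Rightarrow> real) \<Rightarrow> ('e \<times> 'e \<Rightarrow> real) set" where
  "flows r \<mu> = {\<phi>. (\<forall>(x, y)\<in>arcs r \<mu>. \<phi> (x, y) = - \<phi> (y, x)) \<and> (\<forall>e. e \<notin> arcs r \<mu> \<longrightarrow> \<phi> e = 0)}"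

definition flow_inner ::
  "('e \<Rightarrow> 'e \<Rightarrow> real) \<Rightarrow> ('e \<Rightarrow> real) \<Rightarrow> ('e \<times> 'e \<Rightarrow> real) \<Rightarrow> ('e \<times> 'e \<Rightarrow> real) \<Rightarrow> real" where
  "flow_inner r \<mu> \<phi> \<psi> =
     (1/2) * (\<Sum>(x, y)\<in>arcs r \<mu>. 1 / sym_conductance r \<mu> x y * \<phi> (x, y) * \<psi> (x, y))"

definition flow_norm ::
  "('e \<Rightarrow> 'e \<Rightarrow> real) \<Rightarrow> ('e \<Rightarrow> real) \<Rightarrow> ('e \<times> 'e \<Rightarrow> real) \<Rightarrow> real" where
  "flow_norm r \<mu> \<phi> = sqrt (flow_inner r \<mu> \<phi> \<phi>)"

definition flow_div ::
  "('e \<Rightarrow> 'e \<Rightarrow> real) \<Rightarrow> ('e \<Rightarrow> real) \<Rightarrow> ('e \<times> 'e \<Rightarrow> real) \<Rightarrow> 'e \<Rightarrow> real" where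
  "flow_div r \<mu> \<phi> x = (\<Sum>y | (x, y) \<in> arcs r \<mu>. \<phi> (x, y))"

text \<open>
  The flow \<open>\<Phi>\<^sub>f\<close> vanishes off the arcs: on the diagonal by cancellation, and elsewhere because both
  conductances of a pair that is not an arc are \<open>0\<close>, rates and stationary measure being nonnegative.
\<close>

definition Phi_flow ::
  "('e \<Rightarrow> 'e \<Rightarrow> real) \<Rightarrow> ('e \<Rightarrow> real) \<Rightarrow> ('e \<Rightarrow> real) \<Rightarrow> 'e \<times> 'e \<Rightarrow> real" where
  "Phi_flow r \<mu> f = (\<lambda>(x, y). f x * conductance r \<mu> x y - f y * conductance r \<mu> y x)"

end

theory Submission
  imports Defs
begin

text \<open>
  Let \<open>V\<close> be the equilibrium potential (\<open>1\<close> on \<open>A\<close>, \<open>0\<close> on \<open>B\<close>, harmonic elsewhere) and let \<open>\<Psi>\<close> be the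
  flow \<open>c\<^sub>s(x,y) (V x - V y)\<close>. Summation by parts gives \<open>\<langle>\<Phi>\<^sub>f - \<phi>, \<Psi>\<rangle> = \<parallel>\<Psi>\<parallel>\<^sup>2 = cap(A,B)\<close> for all admissible
  \<open>f\<close> and \<open>\<phi>\<close>, so expanding \<open>\<parallel>\<Phi>\<^sub>f - \<phi> - \<Psi>\<parallel>\<^sup>2 \<ge> 0\<close> yields the lower bound. It is attained at
  \<open>f = (V + V*)/2\<close> and \<open>\<phi> = \<Phi>\<^sub>f - \<Psi>\<close>, where \<open>V*\<close> is the equilibrium potential of the time reversal.

  To express the capacity through \<open>V\<close>, the process is observed on the grids of mesh \<open>\<delta>\<close>. By
  right-continuity, on every path the skeleton eventually decides correctly, as \<open>\<delta> \<rightarrow> 0\<close>, which of \<open>A\<close>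
  and \<open>B\<close> is visited first after leaving the starting point. For the skeleton chain the hitting
  probabilities solve a discrete Dirichlet problem; dividing it by \<open>\<delta>\<close> and passing to the limit along
  a subsequence gives the equations for \<open>1 - V\<close>.
\<close>

section \<open>The Dirichlet principle for circulations\<close>

text \<open>With \<open>c x y = \<mu> x * r x y\<close> this is the negative generator applied to
  \<open>g\<close>, weighted by \<open>\<mu> x\<close>. The diagonal of \<open>c\<close> drops
  out.\<close>

definition laplacian :: "('e::finite \<Rightarrow> 'e \<Rightarrow> real) \<Rightarrow> ('e \<Rightarrow> real) \<Rightarrow> 'e \<Rightarrow> real" where
  "laplacian c g x = (\<Sum>y\<in>UNIV. c x y * (g x - g y))"

text \<open>Balance of inflow and outflow is what stationarity of \<mu> says about conductances. The
  transposed kernel is the one of the time reversal.\<close>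

locale circulation =
  fixes c :: "'e::finite \<Rightarrow> 'e \<Rightarrow> real"
  assumes nonneg: "c x y \<ge> 0"
    and balance: "(\<Sum>y\<in>UNIV. c x y) = (\<Sum>y\<in>UNIV. c y x)"
    and irred: "(x, y) \<in> {(u, v). c u v > 0}\<^sup>*"
begin

text \<open>Cross terms match after exchanging the summation variables, diagonal terms by
  \<open>balance\<close>. So the adjoint of the Laplacian is the Laplacian of the transposed
  kernel.\<close>

lemma green: "(\<Sum>x\<in>UNIV. f x * laplacian c g x) = (\<Sum>x\<in>UNIV. g x * laplacian (\<lambda>x y. c y x) f x)"
proof -
  have "(\<Sum>x\<in>UNIV. f x * laplacian c g x)
      = (\<Sum>x\<in>UNIV. f x * g x * (\<Sum>y\<in>UNIV. c x y)) - (\<Sum>x\<in>UNIV. \<Sum>y\<in>UNIV. f x * c x y * g y)"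
    unfolding laplacian_def
    by (simp add: sum_distrib_left sum_subtractf [symmetric] algebra_simps)
  also have "(\<Sum>x\<in>UNIV. \<Sum>y\<in>UNIV. f x * c x y * g y) = (\<Sum>x\<in>UNIV. \<Sum>y\<in>UNIV. f y * c y x * g x)"
    by (rule sum.swap)
  also have "(\<Sum>x\<in>UNIV. f x * g x * (\<Sum>y\<in>UNIV. c x y)) - (\<Sum>x\<in>UNIV. \<Sum>y\<in>UNIV. f y * c y x * g x)
      = (\<Sum>x\<in>UNIV. g x * laplacian (\<lambda>x y. c y x) f x)"
    unfolding laplacian_def balance
    by (simp add: sum_distrib_left sum_subtractf [symmetric] algebra_simps)
  finally show ?thesis .
qed

text \<open>Twice \<open>g x * (g x - g y)\<close> is the squared difference plus
  \<open>(g x)\<^sup>2 - (g y)\<^sup>2\<close>, and \<open>balance\<close> cancels the last two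
  terms in the sum.\<close>

lemma dirichlet_energy:
  "(\<Sum>x\<in>UNIV. g x * laplacian c g x) = (\<Sum>x\<in>UNIV. \<Sum>y\<in>UNIV. c x y * (g x - g y)\<^sup>2) / 2"
proof -
  have "(\<Sum>x\<in>UNIV. \<Sum>y\<in>UNIV. c x y * (g x - g y)\<^sup>2)
      = (\<Sum>x\<in>UNIV. \<Sum>y\<in>UNIV. 2 * (c x y * (g x - g y) * g x) - c x y * (g x)\<^sup>2 + c x y * (g y)\<^sup>2)"
    by (intro sum.cong refl) (simp add: power2_eq_square algebra_simps)
  also have "\<dots> = 2 * (\<Sum>x\<in>UNIV. g x * laplacian c g x)
      - (\<Sum>x\<in>UNIV. \<Sum>y\<in>UNIV. c x y * (g x)\<^sup>2) + (\<Sum>x\<in>UNIV. \<Sum>y\<in>UNIV. c x y * (g y)\<^sup>2)"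
    by (simp add: sum.distrib sum_subtractf laplacian_def sum_distrib_left mult_ac)
  also have "(\<Sum>x\<in>UNIV. \<Sum>y\<in>UNIV. c x y * (g x)\<^sup>2) = (\<Sum>x\<in>UNIV. \<Sum>y\<in>UNIV. c y x * (g x)\<^sup>2)"
    using balance by (simp flip: sum_distrib_right)
  also have "\<dots> = (\<Sum>x\<in>UNIV. \<Sum>y\<in>UNIV. c x y * (g y)\<^sup>2)"
    by (rule sum.swap)
  finally show ?thesis by simp
qed

text \<open>Energy argument: \<open>g\<close> times its adjoint Laplacian vanishes everywhere, so
  the energy is zero and \<open>g\<close> is constant along edges of positive conductance.
  Irreducibility links every state to \<open>s\<close>.\<close>

lemma adjoint_dirichlet_unique:
  assumes "s \<in> S" and zero: "\<And>x. x \<in> S \<Longrightarrow> g x = 0"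
    and harm: "\<And>x. x \<notin> S \<Longrightarrow> laplacian (\<lambda>x y. c y x) g x = 0"
  shows "g x = 0"
proof -
  have "(\<Sum>x\<in>UNIV. \<Sum>y\<in>UNIV. c x y * (g x - g y)\<^sup>2) = 0"
  proof -
    have "g x * laplacian (\<lambda>x y. c y x) g x = 0" for x
      using zero harm by (cases "x \<in> S") simp_all
    then have "(\<Sum>x\<in>UNIV. g x * laplacian (\<lambda>x y. c y x) g x) = 0"
      by (rule sum.neutral[OF ballI])
    then show ?thesis
      using dirichlet_energy[of g] green[of g g] by simp
  qed
  then have "c u v * (g u - g v)\<^sup>2 = 0" for u v
    using nonneg by (simp add: sum_nonneg_eq_0_iff sum_nonneg)
  then have edge: "g u = g v" if "c u v > 0" for u v
    using that by (metis eq_iff_diff_eq_0 less_irrefl mult_eq_0_iff power_eq_0_iff)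
  have "(x, s) \<in> {(u, v). c u v > 0}\<^sup>*"
    by (rule irred)
  then have "g x = g s"
    by (induction rule: rtrancl_induct) (use edge in auto)
  with assms(1) zero show ?thesis by simp
qed

text \<open>The map \<open>T\<close> records boundary values on \<open>S\<close> and the adjoint
  Laplacian off \<open>S\<close>. It is an endomorphism of a finite-dimensional space, injective by
  uniqueness and hence surjective.\<close>

lemma adjoint_dirichlet_exists:
  assumes "S \<noteq> {}"
  obtains g where "\<And>x. x \<in> S \<Longrightarrow> g x = f x"
    and "\<And>x. x \<notin> S \<Longrightarrow> laplacian (\<lambda>x y. c y x) g x = 0"
proof -
  define T :: "real ^ 'e \<Rightarrow> real ^ 'e" where
    "T v = (\<chi> x. if x \<in> S then v $ x else laplacian (\<lambda>x y. c y x) (($) v) x)" for v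
  have lin: "linear T"
    by (rule linearI) (auto simp: T_def vec_eq_iff laplacian_def algebra_simps
        sum.distrib[symmetric] sum_subtractf[symmetric] sum_distrib_left intro!: sum.cong)
  obtain s where "s \<in> S"
    using assms by blast
  have "inj T"
    unfolding linear_injective_0[OF lin]
  proof (intro allI impI)
    fix v assume "T v = 0"
    then have v: "(if x \<in> S then v $ x else laplacian (\<lambda>x y. c y x) (($) v) x) = 0" for x
      by (simp add: T_def vec_eq_iff)
    have "v $ x = 0" for x
      by (rule adjoint_dirichlet_unique[OF \<open>s \<in> S\<close>]) (use v in \<open>metis (full_types)\<close>)+
    then show "v = 0"
      by (simp add: vec_eq_iff)
  qed
  then obtain v where "T v = (\<chi> x. if x \<in> S then f x else 0)"
    using linear_injective_imp_surjective[OF lin] by (metis surjD)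
  then have "(if x \<in> S then v $ x else laplacian (\<lambda>x y. c y x) (($) v) x)
      = (if x \<in> S then f x else 0)" for x
    by (simp add: T_def vec_eq_iff)
  then show thesis
    by (intro that[of "($) v"]) (metis (full_types))+
qed

end

text \<open>The values \<open>r x x\<close> are arbitrary and may be negative, so the diagonal is
  erased before a nonnegative kernel is claimed.\<close>

definition off_diag :: "('e \<Rightarrow> 'e \<Rightarrow> real) \<Rightarrow> 'e \<Rightarrow> 'e \<Rightarrow> real" where
  "off_diag k x y = (if x = y then 0 else k x y)"

section \<open>Flows, gradient flows and summation by parts\<close>

definition gradient_flow :: "('e \<Rightarrow> 'e \<Rightarrow> real) \<Rightarrow> ('e \<Rightarrow> real) \<Rightarrow> ('e \<Rightarrow> real) \<Rightarrow> 'e \<times> 'e \<Rightarrow> real" where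
  "gradient_flow r \<mu> g = (\<lambda>(x, y). if (x, y) \<in> arcs r \<mu> then sym_conductance r \<mu> x y * (g x - g y) else 0)"

lemma flow_inner_diff_self:
  "flow_inner r \<mu> (\<phi> - \<psi>) (\<phi> - \<psi>) =
    flow_inner r \<mu> \<phi> \<phi> - 2 * flow_inner r \<mu> \<phi> \<psi> + flow_inner r \<mu> \<psi> \<psi>"
proof -
  have "(\<Sum>(x, y)\<in>arcs r \<mu>. 1 / sym_conductance r \<mu> x y * (\<phi> - \<psi>) (x, y) * (\<phi> - \<psi>) (x, y)) =
    (\<Sum>(x, y)\<in>arcs r \<mu>. 1 / sym_conductance r \<mu> x y * \<phi> (x, y) * \<phi> (x, y)) -
    2 * (\<Sum>(x, y)\<in>arcs r \<mu>. 1 / sym_conductance r \<mu> x y * \<phi> (x, y) * \<psi> (x, y)) +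
    (\<Sum>(x, y)\<in>arcs r \<mu>. 1 / sym_conductance r \<mu> x y * \<psi> (x, y) * \<psi> (x, y))"
    unfolding sum_distrib_left sum_subtractf[symmetric] sum.distrib[symmetric]
    by (intro sum.cong refl) (auto simp: algebra_simps add_divide_distrib diff_divide_distrib)
  then show ?thesis
    unfolding flow_inner_def by (simp only: distrib_left right_diff_distrib)
qed

lemma flow_inner_self_nonneg: "flow_inner r \<mu> \<phi> \<phi> \<ge> 0"
  unfolding flow_inner_def by (auto intro!: mult_nonneg_nonneg sum_nonneg simp: arcs_def)

lemma flow_norm_square: "(flow_norm r \<mu> \<phi>)\<^sup>2 = flow_inner r \<mu> \<phi> \<phi>"
  by (simp add: flow_norm_def flow_inner_self_nonneg)

lemma sym_conductance_commute: "sym_conductance r \<mu> x y = sym_conductance r \<mu> y x"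
  by (simp add: sym_conductance_def)

lemma arcs_commute: "(x, y) \<in> arcs r \<mu> \<longleftrightarrow> (y, x) \<in> arcs r \<mu>"
  by (auto simp: arcs_def sym_conductance_commute)

lemma flows_antisym:
  assumes "\<phi> \<in> flows r \<mu>"
  shows "\<phi> (x, y) = - \<phi> (y, x)"
  using assms arcs_commute[of x y r \<mu>] by (cases "(x, y) \<in> arcs r \<mu>") (auto simp: flows_def)

lemma flows_diff: "\<phi> \<in> flows r \<mu> \<Longrightarrow> \<psi> \<in> flows r \<mu> \<Longrightarrow> \<phi> - \<psi> \<in> flows r \<mu>"
  by (fastforce simp: flows_def)

lemma flow_div_diff: "flow_div r \<mu> (\<phi> - \<psi>) x = flow_div r \<mu> \<phi> x - flow_div r \<mu> \<psi> x"
  by (simp add: flow_div_def sum_subtractf)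

lemma flow_div_eq:
  fixes \<phi> :: "'e::finite \<times> 'e \<Rightarrow> real"
  assumes "\<phi> \<in> flows r \<mu>"
  shows "flow_div r \<mu> \<phi> x = (\<Sum>y\<in>UNIV. \<phi> (x, y))"
  unfolding flow_div_def by (rule sum.mono_neutral_left) (use assms in \<open>auto simp: flows_def\<close>)

lemma gradient_flow_in_flows: "gradient_flow r \<mu> g \<in> flows r \<mu>"
  using arcs_commute[of _ _ r \<mu>]
  by (auto simp: gradient_flow_def flows_def sym_conductance_commute algebra_simps)

text \<open>Summation by parts. The weight \<open>1 / sym_conductance\<close> cancels against the
  gradient flow, and antisymmetry makes the \<open>g x\<close> and \<open>g y\<close> halves equal,
  which absorbs the factor 1/2.\<close>

lemma flow_inner_gradient:
  fixes \<phi> :: "'e::finite \<times> 'e \<Rightarrow> real"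
  assumes "\<phi> \<in> flows r \<mu>"
  shows "flow_inner r \<mu> \<phi> (gradient_flow r \<mu> g) = (\<Sum>x\<in>UNIV. g x * flow_div r \<mu> \<phi> x)"
proof -
  have "(\<Sum>(x, y)\<in>arcs r \<mu>. 1 / sym_conductance r \<mu> x y * \<phi> (x, y) * gradient_flow r \<mu> g (x, y))
      = (\<Sum>(x, y)\<in>arcs r \<mu>. \<phi> (x, y) * (g x - g y))"
    by (rule sum.cong) (auto simp: gradient_flow_def arcs_def)
  also have "\<dots> = (\<Sum>(x, y)\<in>UNIV. \<phi> (x, y) * (g x - g y))"
    by (rule sum.mono_neutral_left) (use assms in \<open>auto simp: flows_def\<close>)
  also have "\<dots> = (\<Sum>x\<in>UNIV. \<Sum>y\<in>UNIV. \<phi> (x, y) * (g x - g y))"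
    by (simp add: sum.cartesian_product)
  also have "\<dots> = (\<Sum>x\<in>UNIV. \<Sum>y\<in>UNIV. g x * \<phi> (x, y)) - (\<Sum>x\<in>UNIV. \<Sum>y\<in>UNIV. g y * \<phi> (x, y))"
    by (simp add: sum_subtractf[symmetric] algebra_simps)
  also have "(\<Sum>x\<in>UNIV. \<Sum>y\<in>UNIV. g y * \<phi> (x, y)) = (\<Sum>x\<in>UNIV. \<Sum>y\<in>UNIV. g x * \<phi> (y, x))"
    by (rule sum.swap)
  also have "\<dots> = - (\<Sum>x\<in>UNIV. \<Sum>y\<in>UNIV. g x * \<phi> (x, y))"
    unfolding sum_negf[symmetric] by (intro sum.cong refl) (metis flows_antisym[OF assms] mult_minus_right)
  finally show ?thesis
    by (simp add: flow_inner_def flow_div_eq[OF assms] sum_distrib_left)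
qed

section \<open>Divergences and the variational formula for conductances that form a
  circulation\<close>

locale flow_circulation =
  fixes r :: "'e::finite \<Rightarrow> 'e \<Rightarrow> real" and \<mu> :: "'e \<Rightarrow> real"
  assumes circulation: "circulation (off_diag (conductance r \<mu>))"
begin

abbreviation (input) c where "c \<equiv> off_diag (conductance r \<mu>)"
abbreviation (input) c_adj where "c_adj \<equiv> (\<lambda>x y. c y x)"

sublocale circulation c
  by (rule circulation)

lemma conductance_nonneg: "x \<noteq> y \<Longrightarrow> conductance r \<mu> x y \<ge> 0"
  using nonneg[of x y] by (simp add: off_diag_def)

lemma non_arc: "x \<noteq> y \<Longrightarrow> (x, y) \<notin> arcs r \<mu> \<Longrightarrow> conductance r \<mu> x y = 0 \<and> conductance r \<mu> y x = 0"
  using conductance_nonneg[of x y] conductance_nonneg[of y x] by (auto simp: arcs_def sym_conductance_def)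

lemma Phi_flow_in_flows: "Phi_flow r \<mu> f \<in> flows r \<mu>"
proof -
  have "Phi_flow r \<mu> f (x, y) = 0" if "(x, y) \<notin> arcs r \<mu>" for x y
    using non_arc[of x y] that by (cases "x = y") (auto simp: Phi_flow_def)
  then show ?thesis
    by (auto simp: flows_def Phi_flow_def)
qed

text \<open>\<open>balance\<close> replaces the total outflow at \<open>x\<close> by the total
  inflow, which turns the divergence into an adjoint Laplacian.\<close>

lemma div_Phi_flow: "flow_div r \<mu> (Phi_flow r \<mu> f) x = laplacian c_adj f x"
proof -
  have "flow_div r \<mu> (Phi_flow r \<mu> f) x = (\<Sum>y\<in>UNIV. f x * c x y - f y * c y x)"
    unfolding flow_div_eq[OF Phi_flow_in_flows]
    by (intro sum.cong refl) (simp add: Phi_flow_def off_diag_def)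
  also have "\<dots> = f x * (\<Sum>y\<in>UNIV. c x y) - (\<Sum>y\<in>UNIV. f y * c y x)"
    by (simp add: sum_subtractf sum_distrib_left)
  also have "\<dots> = laplacian c_adj f x"
    unfolding balance laplacian_def by (simp add: sum_distrib_left sum_subtractf algebra_simps)
  finally show ?thesis .
qed

lemma div_gradient_flow:
  "flow_div r \<mu> (gradient_flow r \<mu> g) x = (laplacian c g x + laplacian c_adj g x) / 2"
proof -
  have "gradient_flow r \<mu> g (x, y) = (c x y * (g x - g y) + c y x * (g x - g y)) / 2" for y
    using non_arc[of x y] by (cases "x = y")
      (auto simp: gradient_flow_def off_diag_def sym_conductance_def field_simps)
  then show ?thesis
    unfolding flow_div_eq[OF gradient_flow_in_flows] laplacian_def
    by (simp add: sum.distrib[symmetric] sum_divide_distrib del: eq_divide_eq_numeral1)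
qed

text \<open>Summation by parts against the constant 1, whose gradient flow is zero.\<close>

lemma sum_flow_div:
  assumes "\<phi> \<in> flows r \<mu>"
  shows "(\<Sum>x\<in>UNIV. flow_div r \<mu> \<phi> x) = 0"
  using flow_inner_gradient[OF assms, of "\<lambda>_. 1"] by (simp add: flow_inner_def gradient_flow_def case_prod_unfold)

text \<open>The divergence is the mean of both Laplacians, and by \<open>green\<close> both have the
  same quadratic form.\<close>

lemma inner_gradient_self:
  "flow_inner r \<mu> (gradient_flow r \<mu> g) (gradient_flow r \<mu> g) = (\<Sum>x\<in>UNIV. g x * laplacian c g x)"
  unfolding flow_inner_gradient[OF gradient_flow_in_flows] div_gradient_flow
  using green[of g g]
  by (simp add: field_simps sum.distrib sum_divide_distrib[symmetric])

lemma sum_boundary: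
  fixes f g :: "'e \<Rightarrow> real"
  assumes "A \<inter> B = {}" and "\<And>x. x \<in> A \<Longrightarrow> f x = 1" and "\<And>x. x \<in> B \<Longrightarrow> f x = 0"
    and "\<And>x. x \<notin> A \<union> B \<Longrightarrow> g x = 0"
  shows "(\<Sum>x\<in>UNIV. f x * g x) = (\<Sum>x\<in>A. g x)"
proof -
  have "(\<Sum>x\<in>UNIV. f x * g x) = (\<Sum>x\<in>A. f x * g x)"
    by (rule sum.mono_neutral_right) (use assms in auto)
  with assms(2) show ?thesis by simp
qed

text \<open>The potential \<open>V\<close> enters as data, since it is later obtained from the
  process; the potential of the time reversal is constructed inside the proof by linear
  algebra.\<close>

theorem dirichlet_principle:
  assumes AB: "A \<inter> B = {}" and "A \<noteq> {}"
    and V: "\<And>x. x \<in> A \<Longrightarrow> V x = 1" "\<And>x. x \<in> B \<Longrightarrow> V x = 0"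
      "\<And>x. x \<notin> A \<union> B \<Longrightarrow> laplacian c V x = 0"
  shows "(\<Sum>x\<in>A. laplacian c V x) =
    (INF f\<in>{f. (\<forall>x\<in>A. f x = 1) \<and> (\<forall>x\<in>B. f x = 0)}.
     INF \<phi>\<in>{\<phi> \<in> flows r \<mu>.
              (\<forall>x. x \<notin> A \<union> B \<longrightarrow> flow_div r \<mu> \<phi> x = 0) \<and>
              (\<Sum>a\<in>A. flow_div r \<mu> \<phi> a) = 0 \<and>
              (\<Sum>b\<in>B. flow_div r \<mu> \<phi> b) = 0}.
       (flow_norm r \<mu> (Phi_flow r \<mu> f - \<phi>))\<^sup>2)" (is "?cap = (INF f\<in>?FF. INF \<phi>\<in>?FL. ?N f \<phi>)")
proof -
  let ?\<Psi> = "gradient_flow r \<mu> V"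
  have bound: "?cap \<le> ?N f \<phi>" if f: "f \<in> ?FF" and \<phi>: "\<phi> \<in> ?FL" for f \<phi>
  proof -
    let ?\<psi> = "Phi_flow r \<mu> f - \<phi>"
    \<comment> \<open>\<open>V\<close> is constant on \<open>A\<close> and zero on \<open>B\<close>,
      so only the total divergence over \<open>A\<close> is left, and admissibility makes it
      zero.\<close>
    have "(\<Sum>x\<in>UNIV. V x * flow_div r \<mu> \<phi> x) = 0"
      using \<phi> sum_boundary[OF AB V(1,2), where g = "flow_div r \<mu> \<phi>"] by auto
    moreover have "(\<Sum>x\<in>UNIV. V x * laplacian c_adj f x) = ?cap"
      unfolding green[symmetric] using f V(3) by (intro sum_boundary[OF AB]) auto
    ultimately have "flow_inner r \<mu> ?\<psi> ?\<Psi> = ?cap"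
      using \<phi> by (subst flow_inner_gradient)
        (auto simp: flows_diff Phi_flow_in_flows flow_div_diff div_Phi_flow right_diff_distrib sum_subtractf)
    moreover have "flow_inner r \<mu> ?\<Psi> ?\<Psi> = ?cap"
      unfolding inner_gradient_self by (rule sum_boundary[OF AB V])
    ultimately show ?thesis
      using flow_inner_self_nonneg[of r \<mu> "?\<psi> - ?\<Psi>"]
      by (simp add: flow_inner_diff_self[of r \<mu> ?\<psi>] flow_norm_square)
  qed
  obtain V' where V': "\<And>x. x \<in> A \<union> B \<Longrightarrow> V' x = V x"
    "\<And>x. x \<notin> A \<union> B \<Longrightarrow> laplacian c_adj V' x = 0"
    using adjoint_dirichlet_exists[of "A \<union> B" V] \<open>A \<noteq> {}\<close> by blast
  define f0 where "f0 x = (V x + V' x) / 2" for x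
  have f0: "f0 \<in> ?FF"
    using V V' by (simp add: f0_def)
  define \<phi>0 where "\<phi>0 = Phi_flow r \<mu> f0 - ?\<Psi>"
  have flow0: "\<phi>0 \<in> flows r \<mu>"
    unfolding \<phi>0_def by (intro flows_diff Phi_flow_in_flows gradient_flow_in_flows)
  have "laplacian c_adj f0 x = (laplacian c_adj V x + laplacian c_adj V' x) / 2" for x
    unfolding laplacian_def f0_def sum_divide_distrib sum.distrib[symmetric]
    by (intro sum.cong refl) (simp add: field_simps)
  \<comment> \<open>The adjoint Laplacian of \<open>V\<close> occurs in the divergences of both
    \<Phi> and \<Psi> and cancels. This is why \<open>f0\<close> averages \<open>V\<close> and
    \<open>V'\<close>; the remainder vanishes off \<open>A \<union> B\<close>.\<close>
  then have div0: "flow_div r \<mu> \<phi>0 x = (laplacian c_adj V' x - laplacian c V x) / 2" for x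
    by (simp add: \<phi>0_def flow_div_diff div_Phi_flow div_gradient_flow field_simps)
  have out: "flow_div r \<mu> \<phi>0 x = 0" if "x \<notin> A \<union> B" for x
    by (simp only: div0 V(3)[OF that] V'(2)[OF that]) simp
  \<comment> \<open>The chain and its time reversal have the same capacity: both sums over
    \<open>A\<close> are pairings of the two potentials, exchanged by \<open>green\<close>.\<close>
  have "(\<Sum>x\<in>A. laplacian c_adj V' x) = (\<Sum>x\<in>UNIV. V x * laplacian c_adj V' x)"
    by (rule sum_boundary[OF AB V(1,2) V'(2), symmetric])
  also have "\<dots> = (\<Sum>x\<in>UNIV. V' x * laplacian c V x)"
    by (rule green[symmetric])
  also have "\<dots> = ?cap"
    using V V' by (intro sum_boundary[OF AB]) auto
  finally have A0: "(\<Sum>x\<in>A. flow_div r \<mu> \<phi>0 x) = 0"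
    by (simp add: div0 sum_subtractf flip: sum_divide_distrib)
  \<comment> \<open>The total divergence of a flow is zero, so the part over \<open>B\<close>
    vanishes together with the part over \<open>A\<close>.\<close>
  have "(\<Sum>x\<in>UNIV. flow_div r \<mu> \<phi>0 x) = (\<Sum>x\<in>A \<union> B. flow_div r \<mu> \<phi>0 x)"
    by (rule sum.mono_neutral_right) (use out in auto)
  then have B0: "(\<Sum>x\<in>B. flow_div r \<mu> \<phi>0 x) = 0"
    using A0 AB sum_flow_div[OF flow0] by (simp add: sum.union_disjoint)
  have \<phi>0: "\<phi>0 \<in> ?FL"
    using flow0 out A0 B0 by simp
  have "flow_inner r \<mu> ?\<Psi> ?\<Psi> = ?cap"
    unfolding inner_gradient_self by (rule sum_boundary[OF AB V])
  then have attained: "?N f0 \<phi>0 = ?cap"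
    by (simp add: flow_norm_square \<phi>0_def fun_diff_def)
  \<comment> \<open>The infima are over reals, so each level needs a nonempty set and a lower bound;
    \<open>inner\<close> is the lower bound for the outer level.\<close>
  have inner: "?cap \<le> (INF \<phi>\<in>?FL. ?N f \<phi>)" if "f \<in> ?FF" for f
    using \<phi>0 by (intro cINF_greatest bound[OF that]) blast+
  have "(INF \<phi>\<in>?FL. ?N f0 \<phi>) \<le> ?cap"
    unfolding attained[symmetric]
    by (intro cINF_lower \<phi>0 bdd_belowI2[where m = ?cap] bound[OF f0])
  then have "(INF f\<in>?FF. INF \<phi>\<in>?FL. ?N f \<phi>) \<le> ?cap"
    by (intro cINF_lower2[OF _ f0] bdd_belowI2[where m = ?cap] inner)
  moreover have "?cap \<le> (INF f\<in>?FF. INF \<phi>\<in>?FL. ?N f \<phi>)"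
    using f0 by (intro cINF_greatest inner) blast+
  ultimately show ?thesis by simp
qed

end

section \<open>Right-continuous paths and their skeletons\<close>

locale right_continuous_path =
  fixes w :: "real \<Rightarrow> 'e"
  assumes right_cont: "t \<ge> 0 \<Longrightarrow> \<exists>\<epsilon>>0. \<forall>s\<in>{t..<t + \<epsilon>}. w s = w t"
begin

lemma right_contE:
  assumes "t \<ge> 0"
  obtains \<epsilon> where "\<epsilon> > 0" "\<And>s. t \<le> s \<Longrightarrow> s < t + \<epsilon> \<Longrightarrow> w s = w t"
  using right_cont[OF assms] by (metis atLeastLessThan_iff)

text \<open>The infimum of the times at which \<open>Q\<close> holds is attained: the path is
  constant just after it, and such times occur there.\<close>

lemma first_time:
  assumes "0 \<le> t0" "t0 \<le> t1" "Q (w t1)"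
  obtains t where "t0 \<le> t" "t \<le> t1" "Q (w t)" "\<And>s. t0 \<le> s \<Longrightarrow> s < t \<Longrightarrow> \<not> Q (w s)"
proof -
  define T where "T = {t. t0 \<le> t \<and> Q (w t)}"
  have "t1 \<in> T" and bdd: "bdd_below T"
    using assms by (auto simp: T_def intro: bdd_belowI[of _ t0])
  then have "Inf T \<le> t1" and "t0 \<le> Inf T"
    by (auto simp: T_def intro: cInf_lower cInf_greatest)
  obtain \<epsilon> where "\<epsilon> > 0" and \<epsilon>: "\<And>s. Inf T \<le> s \<Longrightarrow> s < Inf T + \<epsilon> \<Longrightarrow> w s = w (Inf T)"
    using right_contE[of "Inf T"] assms(1) \<open>t0 \<le> Inf T\<close> by (metis order_trans)
  then obtain t where "t \<in> T" "t < Inf T + \<epsilon>"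
    using cInf_lessD[of T "Inf T + \<epsilon>"] \<open>t1 \<in> T\<close> by auto
  then have "Q (w (Inf T))"
    using \<epsilon>[of t] cInf_lower[OF _ bdd, of t] by (auto simp: T_def)
  moreover have "\<not> Q (w s)" if "t0 \<le> s" "s < Inf T" for s
    using that cInf_lower[OF _ bdd, of s] by (auto simp: T_def)
  ultimately show thesis
    using that \<open>t0 \<le> Inf T\<close> \<open>Inf T \<le> t1\<close> by blast
qed

lemma first_exit:
  assumes "0 \<le> s" "w s \<noteq> w 0"
  obtains a where "0 < a" "a \<le> s" "w a \<noteq> w 0" "\<And>u. 0 \<le> u \<Longrightarrow> u < a \<Longrightarrow> w u = w 0"
proof -
  obtain a where a: "0 \<le> a" "a \<le> s" "w a \<noteq> w 0" "\<And>u. 0 \<le> u \<Longrightarrow> u < a \<Longrightarrow> \<not> w u \<noteq> w 0"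
    by (rule first_time[of 0 s "\<lambda>x. x \<noteq> w 0", OF order_refl assms]) blast
  moreover from a(1,3) have "0 < a"
    by (cases "a = 0") auto
  ultimately show thesis
    using that by blast
qed

end

text \<open>The event that \<open>B\<close> is visited before \<open>A\<close> after the first jump,
  at time \<open>a\<close>, written without infima. Conditions start at \<open>a\<close>, so the
  starting state may lie in \<open>A\<close> or \<open>B\<close>.\<close>

definition exits_to_avoiding :: "(real \<Rightarrow> 'e) \<Rightarrow> 'e set \<Rightarrow> 'e set \<Rightarrow> bool" where
  "exits_to_avoiding w B A \<longleftrightarrow> (\<exists>a b. 0 < a \<and> a \<le> b \<and> (\<forall>s. 0 \<le> s \<and> s < a \<longrightarrow> w s = w 0) \<and>
     w a \<noteq> w 0 \<and> w b \<in> B \<and> (\<forall>s. a \<le> s \<and> s \<le> b \<longrightarrow> w s \<notin> A))"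

text \<open>The first new state is seen at index \<open>Suc k\<close>, and \<open>m = 0\<close>
  means that it already lies in \<open>B\<close>. A given sequence admits at most one pair
  \<open>k\<close>, \<open>m\<close>, so the events can be summed.\<close>

definition skeleton_exits :: "(nat \<Rightarrow> 'e) \<Rightarrow> 'e set \<Rightarrow> 'e set \<Rightarrow> nat \<Rightarrow> nat \<Rightarrow> bool" where
  "skeleton_exits v B A k m \<longleftrightarrow> (\<forall>i\<le>k. v i = v 0) \<and> v (Suc k) \<noteq> v 0 \<and>
     (\<forall>i<m. v (Suc k + i) \<notin> A \<union> B) \<and> v (Suc k + m) \<in> B"

lemma grid_point:
  fixes \<delta> t :: real
  assumes "\<delta> > 0" "t \<ge> 0"
  shows "t \<le> real (nat \<lceil>t / \<delta>\<rceil>) * \<delta>" "real (nat \<lceil>t / \<delta>\<rceil>) * \<delta> < t + \<delta>"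
proof -
  have n: "real (nat \<lceil>t / \<delta>\<rceil>) = of_int \<lceil>t / \<delta>\<rceil>"
    using assms by simp
  have "t / \<delta> \<le> real (nat \<lceil>t / \<delta>\<rceil>)" "real (nat \<lceil>t / \<delta>\<rceil>) < t / \<delta> + 1"
    unfolding n by linarith+
  then have "t / \<delta> * \<delta> \<le> real (nat \<lceil>t / \<delta>\<rceil>) * \<delta>" "real (nat \<lceil>t / \<delta>\<rceil>) * \<delta> < (t / \<delta> + 1) * \<delta>"
    using assms(1) by (intro mult_right_mono mult_strict_right_mono; simp)+
  then show "t \<le> real (nat \<lceil>t / \<delta>\<rceil>) * \<delta>" "real (nat \<lceil>t / \<delta>\<rceil>) * \<delta> < t + \<delta>"
    using assms(1) by (simp_all add: distrib_right)
qed

context right_continuous_path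
begin

text \<open>Take the mesh below the lengths of constancy after \<open>a\<close> and
  \<open>b\<close>. The first grid point from \<open>a\<close> on then sees the state at
  \<open>a\<close>, the first one from \<open>b\<close> on sees the state at \<open>b\<close>, and
  no grid point in between lies in \<open>A\<close>.\<close>

lemma exits_imp_skeleton:
  assumes "exits_to_avoiding w B A" and disj: "A \<inter> B = {}"
  shows "\<exists>\<epsilon>>0. \<forall>\<delta>. 0 < \<delta> \<and> \<delta> < \<epsilon> \<longrightarrow> (\<exists>k m. skeleton_exits (\<lambda>i. w (real i * \<delta>)) B A k m)"
proof -
  from assms(1) obtain a b where ab: "0 < a" "a \<le> b" and before: "\<And>s. 0 \<le> s \<Longrightarrow> s < a \<Longrightarrow> w s = w 0"
    and "w a \<noteq> w 0" "w b \<in> B" and avoid: "\<And>s. a \<le> s \<Longrightarrow> s \<le> b \<Longrightarrow> w s \<notin> A"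
    unfolding exits_to_avoiding_def by blast
  obtain \<epsilon>1 where \<epsilon>1: "\<epsilon>1 > 0" "\<And>s. a \<le> s \<Longrightarrow> s < a + \<epsilon>1 \<Longrightarrow> w s = w a"
    using right_contE[of a] ab by (metis less_imp_le)
  obtain \<epsilon>2 where \<epsilon>2: "\<epsilon>2 > 0" "\<And>s. b \<le> s \<Longrightarrow> s < b + \<epsilon>2 \<Longrightarrow> w s = w b"
    using right_contE[of b] ab by (metis less_imp_le order_trans)
  show ?thesis
  proof (intro exI[of _ "min \<epsilon>1 \<epsilon>2"] conjI allI impI)
    fix \<delta> assume \<delta>: "0 < \<delta> \<and> \<delta> < min \<epsilon>1 \<epsilon>2"
    define v where "v i = w (real i * \<delta>)" for i
    define j where "j = nat \<lceil>a / \<delta>\<rceil>"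
    have j: "a \<le> real j * \<delta>" "real j * \<delta> < a + \<delta>"
      using grid_point[of \<delta> a] \<delta> ab by (auto simp: j_def)
    have "j \<noteq> 0"
      using j ab by (intro notI) simp
    then obtain k where k: "j = Suc k"
      by (cases j) auto
    have "real k * \<delta> < a"
      using j k \<delta> by (simp add: algebra_simps)
    moreover have "real i * \<delta> \<le> real k * \<delta>" if "i \<le> k" for i
      using that \<delta> by simp
    ultimately have 1: "v i = v 0" if "i \<le> k" for i
      using that before[of "real i * \<delta>"] \<delta> unfolding v_def by fastforce
    have 2: "v (Suc k) \<noteq> v 0"
      using \<epsilon>1(2)[of "real j * \<delta>"] j \<delta> \<open>w a \<noteq> w 0\<close> unfolding k[symmetric] v_def by simp
    define l where "l = nat \<lceil>b / \<delta>\<rceil>"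
    have l: "b \<le> real l * \<delta>" "real l * \<delta> < b + \<delta>"
      using grid_point[of \<delta> b] \<delta> ab by (auto simp: l_def)
    have "j \<le> l"
      using ab \<delta> unfolding j_def l_def by (intro nat_mono ceiling_mono divide_right_mono) auto
    then have "v (j + (l - j)) \<in> B"
      using \<epsilon>2(2)[of "real l * \<delta>"] l \<delta> \<open>w b \<in> B\<close> by (simp add: v_def)
    \<comment> \<open>The grid may meet \<open>B\<close> before index \<open>l\<close>. The least
      index is taken because the earlier ones must avoid \<open>B\<close> as well as
      \<open>A\<close>.\<close>
    define m where "m = (LEAST m. v (j + m) \<in> B)"
    have mB: "v (j + m) \<in> B" and "m \<le> l - j"
      unfolding m_def by (rule LeastI, fact) (rule Least_le, fact)
    have 3: "v (j + i) \<notin> A \<union> B" if "i < m" for i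
    proof -
      have "v (j + i) \<notin> B"
        using that not_less_Least unfolding m_def by blast
      moreover have "v (j + i) \<notin> A"
      proof (cases "real (j + i) * \<delta> \<le> b")
        case True
        moreover have "a \<le> real (j + i) * \<delta>"
          using j(1) \<delta> by (simp add: distrib_right add_increasing2)
        ultimately show ?thesis
          using avoid unfolding v_def by blast
      next
        case False
        have le: "real (j + i) * \<delta> \<le> real l * \<delta>"
          using that \<open>m \<le> l - j\<close> \<delta> by (intro mult_right_mono) auto
        then have "w (real (j + i) * \<delta>) = w b"
          by (intro \<epsilon>2(2)) (use False l \<delta> le in linarith)+
        then show ?thesis
          using \<open>w b \<in> B\<close> disj unfolding v_def by auto
      qed
      ultimately show ?thesis by blast
    qed
    have "skeleton_exits v B A k m"
      using 1 2 3 mB unfolding skeleton_exits_def k by blast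
    then show "\<exists>k m. skeleton_exits (\<lambda>i. w (real i * \<delta>)) B A k m"
      unfolding v_def by blast
  qed (use \<epsilon>1 \<epsilon>2 in auto)
qed

text \<open>Either the path never moves, or it never meets \<open>B\<close> after its exit, or it
  meets \<open>A\<close> at some \<open>s\<close> before its first visit \<open>b\<close> to
  \<open>B\<close>. In the last case a mesh below \<open>b - s\<close> and below the lengths of
  constancy places a grid point in \<open>A\<close> ahead of every later grid point in
  \<open>B\<close>.\<close>

lemma skeleton_imp_exits:
  assumes "\<not> exits_to_avoiding w B A" and disj: "A \<inter> B = {}"
  shows "\<exists>\<epsilon>>0. \<forall>\<delta>. 0 < \<delta> \<and> \<delta> < \<epsilon> \<longrightarrow> \<not> (\<exists>k m. skeleton_exits (\<lambda>i. w (real i * \<delta>)) B A k m)"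
proof (cases "\<exists>t\<ge>0. w t \<noteq> w 0")
  case False
  have "\<not> skeleton_exits (\<lambda>i. w (real i * \<delta>)) B A k m" if "\<delta> > 0" for \<delta> k m
  proof -
    have "w (real (Suc k) * \<delta>) = w 0"
      using False that by (metis mult_nonneg_nonneg of_nat_0_le_iff less_imp_le)
    then show ?thesis
      by (simp add: skeleton_exits_def)
  qed
  then show ?thesis
    by (intro exI[of _ 1]) simp
next
  case True
  then obtain t where "0 \<le> t" "w t \<noteq> w 0"
    by blast
  then obtain a where "0 < a" "a \<le> t" and a: "w a \<noteq> w 0" and before: "\<And>s. 0 \<le> s \<Longrightarrow> s < a \<Longrightarrow> w s = w 0"
    by (rule first_exit) blast
  have "0 \<le> a"
    using \<open>0 < a\<close> by simp
  have after: "a \<le> s" if "0 \<le> s" "w s \<noteq> w 0" for s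
    using before[of s] that by force
  show ?thesis
  proof (cases "\<exists>t\<ge>a. w t \<in> B")
    case False
    have "\<not> skeleton_exits (\<lambda>i. w (real i * \<delta>)) B A k m" if "\<delta> > 0" for \<delta> k m
    proof
      assume "skeleton_exits (\<lambda>i. w (real i * \<delta>)) B A k m"
      then have ex: "w (real (Suc k) * \<delta>) \<noteq> w 0" and "w (real (Suc k + m) * \<delta>) \<in> B"
        by (auto simp: skeleton_exits_def)
      moreover have "real (Suc k) * \<delta> \<le> real (Suc k + m) * \<delta>"
        using that by (intro mult_right_mono) auto
      moreover have "a \<le> real (Suc k) * \<delta>"
        using ex that by (intro after) auto
      ultimately show False
        using False by (meson order_trans)
    qed
    then show ?thesis
      by (intro exI[of _ 1]) auto
  next
    case True
    then obtain u where "a \<le> u" "w u \<in> B"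
      by blast
    then obtain b where "a \<le> b" "w b \<in> B" and b: "\<And>s. a \<le> s \<Longrightarrow> s < b \<Longrightarrow> w s \<notin> B"
      by (rule first_time[OF \<open>0 \<le> a\<close>, of _ "\<lambda>x. x \<in> B"]) blast
    with assms(1) obtain s where s: "a \<le> s" "s \<le> b" "w s \<in> A"
      unfolding exits_to_avoiding_def using \<open>0 < a\<close> before a by blast
    then have "s < b"
      using \<open>w b \<in> B\<close> disj by (cases "s = b") auto
    obtain \<epsilon>1 where \<epsilon>1: "\<epsilon>1 > 0" "\<And>t. a \<le> t \<Longrightarrow> t < a + \<epsilon>1 \<Longrightarrow> w t = w a"
      using right_contE[of a] \<open>0 \<le> a\<close> by metis
    obtain \<epsilon>2 where \<epsilon>2: "\<epsilon>2 > 0" "\<And>t. s \<le> t \<Longrightarrow> t < s + \<epsilon>2 \<Longrightarrow> w t = w s"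
      using right_contE[of s] s(1) \<open>0 \<le> a\<close> by (metis order_trans)
    have "\<not> skeleton_exits (\<lambda>i. w (real i * \<delta>)) B A k m"
      if \<delta>: "0 < \<delta>" "\<delta> < min \<epsilon>1 (min \<epsilon>2 (b - s))" for \<delta> k m
    proof
      assume "skeleton_exits (\<lambda>i. w (real i * \<delta>)) B A k m"
      then have stay: "\<And>i. i \<le> k \<Longrightarrow> w (real i * \<delta>) = w 0" and ex: "w (real (Suc k) * \<delta>) \<noteq> w 0"
        and av: "\<And>i. i < m \<Longrightarrow> w (real (Suc k + i) * \<delta>) \<notin> A \<union> B" and hit: "w (real (Suc k + m) * \<delta>) \<in> B"
        by (auto simp: skeleton_exits_def)
      define j where "j = nat \<lceil>a / \<delta>\<rceil>"
      define l where "l = nat \<lceil>s / \<delta>\<rceil>"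
      have j: "a \<le> real j * \<delta>" "real j * \<delta> < a + \<delta>"
        using grid_point[of \<delta> a] \<delta> \<open>0 \<le> a\<close> by (auto simp: j_def)
      have l: "s \<le> real l * \<delta>" "real l * \<delta> < s + \<delta>"
        using grid_point[of \<delta> s] \<delta> \<open>0 \<le> a\<close> s by (auto simp: l_def)
      have "j \<le> l"
        using s \<delta> unfolding j_def l_def by (intro nat_mono ceiling_mono divide_right_mono) auto
      have "w (real j * \<delta>) \<noteq> w 0"
        using \<epsilon>1(2)[OF j(1)] j(2) \<delta> a by auto
      \<comment> \<open>The skeleton has left its start by index \<open>j\<close>. Hence
        \<open>l\<close>, where it lies in \<open>A\<close>, falls between its exit and its arrival
        in \<open>B\<close>.\<close>
      then have "Suc k \<le> j"
        using stay not_less_eq_eq by blast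
      have "w (real l * \<delta>) \<in> A"
        using \<epsilon>2(2)[OF l(1)] l(2) \<delta> s by auto
      have "a \<le> real (Suc k) * \<delta>"
        using ex \<delta> by (intro after) auto
      moreover have "real (Suc k) * \<delta> \<le> real (Suc k + m) * \<delta>"
        using \<delta> by (intro mult_right_mono) auto
      ultimately have "b \<le> real (Suc k + m) * \<delta>"
        using b hit by (meson not_le order_trans)
      then have "real l * \<delta> < real (Suc k + m) * \<delta>"
        using l \<delta> by linarith
      then have "l < Suc k + m"
        using \<delta>(1) by (metis mult_less_cancel_right_pos of_nat_less_iff)
      then have "l - Suc k < m" "Suc k + (l - Suc k) = l"
        using \<open>Suc k \<le> j\<close> \<open>j \<le> l\<close> by linarith+
      then show False
        using av[of "l - Suc k"] \<open>w (real l * \<delta>) \<in> A\<close> by (metis UnCI)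
    qed
    then show ?thesis
      using \<epsilon>1 \<epsilon>2 \<open>s < b\<close> by (intro exI[of _ "min \<epsilon>1 (min \<epsilon>2 (b - s))"]) auto
  qed
qed

end

text \<open>A return must come strictly after a displaced time, so the first jump time
  \<open>a\<close> itself does not count. The state at \<open>a\<close> persists for a while, hence
  the infimum is unaffected by this.\<close>

lemma return_time_less_iff:
  fixes X :: "real \<Rightarrow> 'w \<Rightarrow> 'e"
  assumes "right_continuous_path (\<lambda>t. X t \<omega>)" and disj: "A \<inter> B = {}"
  shows "return_time X B \<omega> < return_time X A \<omega> \<longleftrightarrow> exits_to_avoiding (\<lambda>t. X t \<omega>) B A"
proof
  interpret right_continuous_path "\<lambda>t. X t \<omega>" by fact
  {
    assume "return_time X B \<omega> < return_time X A \<omega>"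
    then obtain b s where b: "0 < b" "X b \<omega> \<in> B" "0 < s" "s < b" "X s \<omega> \<noteq> X 0 \<omega>"
      and less: "ereal b < return_time X A \<omega>"
      unfolding return_time_def[of X B] by (auto simp: Inf_less_iff)
    have notA: "X t \<omega> \<notin> A" if "u < t" "0 < u" "X u \<omega> \<noteq> X 0 \<omega>" "t \<le> b" for u t
    proof
      assume "X t \<omega> \<in> A"
      then have "return_time X A \<omega> \<le> ereal t"
        unfolding return_time_def using that by (intro Inf_lower imageI) auto
      with less that show False
        by (metis ereal_less_eq(3) leD order_trans)
    qed
    obtain a where "0 < a" and a: "a \<le> s" "X a \<omega> \<noteq> X 0 \<omega>" "\<And>u. 0 \<le> u \<Longrightarrow> u < a \<Longrightarrow> X u \<omega> = X 0 \<omega>"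
      by (rule first_exit[OF less_imp_le[OF b(3)] b(5)]) blast
    obtain \<epsilon> where \<epsilon>: "\<epsilon> > 0" "\<And>t. a \<le> t \<Longrightarrow> t < a + \<epsilon> \<Longrightarrow> X t \<omega> = X a \<omega>"
      using right_contE[of a] \<open>0 < a\<close> by (metis less_imp_le)
    \<comment> \<open>Time \<open>a\<close> is not an admissible return, so a slightly later time
      with the same state is tested; it stays within \<open>b\<close>.\<close>
    have "X a \<omega> \<notin> A"
      using \<epsilon>(2)[of "min b (a + \<epsilon> / 2)"] notA[of a "min b (a + \<epsilon> / 2)"] \<epsilon>(1) a(1,2) b \<open>0 < a\<close> by auto
    then have "\<forall>t. a \<le> t \<and> t \<le> b \<longrightarrow> X t \<omega> \<notin> A"
      using notA[of a] a(2) \<open>0 < a\<close> by (metis order_le_less)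
    moreover have "\<forall>u. 0 \<le> u \<and> u < a \<longrightarrow> X u \<omega> = X 0 \<omega>"
      using a(3) by blast
    moreover have "a \<le> b"
      using a(1) b by simp
    ultimately show "exits_to_avoiding (\<lambda>t. X t \<omega>) B A"
      unfolding exits_to_avoiding_def using a(2) b(2) \<open>0 < a\<close> by blast
  }
  assume "exits_to_avoiding (\<lambda>t. X t \<omega>) B A"
  then obtain a b where ab: "0 < a" "a \<le> b" and before: "\<And>s. 0 \<le> s \<Longrightarrow> s < a \<Longrightarrow> X s \<omega> = X 0 \<omega>"
    and "X a \<omega> \<noteq> X 0 \<omega>" "X b \<omega> \<in> B" and avoid: "\<And>s. a \<le> s \<Longrightarrow> s \<le> b \<Longrightarrow> X s \<omega> \<notin> A"
    unfolding exits_to_avoiding_def by blast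
  obtain \<epsilon> where \<epsilon>: "\<epsilon> > 0" "\<And>s. b \<le> s \<Longrightarrow> s < b + \<epsilon> \<Longrightarrow> X s \<omega> = X b \<omega>"
    using right_contE[of b] ab by (metis less_imp_le order_trans)
  \<comment> \<open>As \<open>b\<close> may equal \<open>a\<close>, the later time
    \<open>b + \<epsilon> / 2\<close> witnesses the visit to \<open>B\<close>. Up to
    \<open>b + \<epsilon>\<close> the state stays in \<open>B\<close>, so \<open>A\<close> is not
    yet reached, which makes the inequality strict.\<close>
  have "return_time X B \<omega> \<le> ereal (b + \<epsilon> / 2)"
    unfolding return_time_def using ab \<epsilon>(1) \<epsilon>(2)[of "b + \<epsilon> / 2"] \<open>X a \<omega> \<noteq> X 0 \<omega>\<close> \<open>X b \<omega> \<in> B\<close>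
    by (intro Inf_lower imageI CollectI conjI exI[of _ a]) auto
  also have "\<dots> < ereal (b + \<epsilon>)"
    using \<epsilon> by simp
  also have "\<dots> \<le> return_time X A \<omega>"
    unfolding return_time_def
  proof (intro Inf_greatest, clarify)
    fix t s assume t: "0 < t" "X t \<omega> \<in> A" "0 < s" "s < t" "X s \<omega> \<noteq> X 0 \<omega>"
    then have "a \<le> s"
      using before[of s] by (meson less_imp_le not_le)
    then have "b < t"
      using avoid[of t] t by force
    then show "ereal (b + \<epsilon>) \<le> ereal t"
      using \<epsilon>(2)[of t] t \<open>X b \<omega> \<in> B\<close> disj by force
  qed
  finally show "return_time X B \<omega> < return_time X A \<omega>" .
qed

section \<open>Hitting probabilities\<close>

text \<open>Dominated convergence for indicators. Measurability of \<open>G\<close>, here the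
  return-time event, is derived by writing it as the lower limit of the \<open>E n\<close>.\<close>

lemma (in finite_measure) measure_tendsto_eventually:
  assumes [measurable]: "\<And>n. E n \<in> sets M" and "G \<subseteq> space M"
    and ev: "\<And>\<omega>. \<omega> \<in> space M \<Longrightarrow> \<forall>\<^sub>F n in sequentially. \<omega> \<in> E n \<longleftrightarrow> \<omega> \<in> G"
  shows "(\<lambda>n. measure M (E n)) \<longlonglongrightarrow> measure M G"
proof -
  have "\<omega> \<in> G \<longleftrightarrow> (\<exists>N. \<forall>n\<ge>N. \<omega> \<in> E n)" if om: "\<omega> \<in> space M" for \<omega>
  proof -
    obtain N where "\<And>n. n \<ge> N \<Longrightarrow> \<omega> \<in> E n \<longleftrightarrow> \<omega> \<in> G"
      using ev[OF om] unfolding eventually_sequentially by blast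
    then show ?thesis
      by (metis nat_le_linear)
  qed
  then have "G = {\<omega> \<in> space M. \<exists>N. \<forall>n\<ge>N. \<omega> \<in> E n}"
    using \<open>G \<subseteq> space M\<close> by blast
  then have [measurable]: "G \<in> sets M"
    by simp
  have "(\<lambda>n. integral\<^sup>L M (indicator (E n) :: 'a \<Rightarrow> real)) \<longlonglongrightarrow> integral\<^sup>L M (indicator G)"
  proof (rule integral_dominated_convergence[where w = "\<lambda>_. 1"])
    show "AE \<omega> in M. (\<lambda>n. indicator (E n) \<omega> :: real) \<longlonglongrightarrow> indicator G \<omega>"
    proof (intro AE_I2 tendsto_eventually)
      fix \<omega> assume "\<omega> \<in> space M"
      from ev[OF this] show "\<forall>\<^sub>F n in sequentially. indicator (E n) \<omega> = (indicator G \<omega> :: real)"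
        by eventually_elim (simp add: indicator_def)
    qed
  qed (auto simp: indicator_def)
  then show ?thesis
    by simp
qed

lemma disjoint_family_on_by_label:
  assumes "\<And>i x. i \<in> I \<Longrightarrow> x \<in> F i \<Longrightarrow> g x = i"
  shows "disjoint_family_on F I"
  unfolding disjoint_family_on_def disjoint_iff using assms by metis

locale finite_markov_process =
  fixes P :: "'e::finite \<Rightarrow> 'w measure" and X :: "real \<Rightarrow> 'w \<Rightarrow> 'e"
  assumes markov_process: "markov_process P X"
begin

sublocale prob_space "P x" for x
  using markov_process by (simp add: markov_process_def)

lemma measurable_position [measurable]: "t \<ge> 0 \<Longrightarrow> X t \<in> measurable (P x) (count_space UNIV)"
  using markov_process by (simp add: markov_process_def)

lemma right_continuous: "\<omega> \<in> space (P x) \<Longrightarrow> right_continuous_path (\<lambda>t. X t \<omega>)"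
  using markov_process by (simp add: markov_process_def right_continuous_path_def)

lemma AE_start: "AE \<omega> in P x. X 0 \<omega> = x"
  using markov_process by (simp add: markov_process_def)

definition trans_prob :: "real \<Rightarrow> 'e \<Rightarrow> 'e \<Rightarrow> real" where
  "trans_prob t x y = \<P>(\<omega> in P x. X t \<omega> = y)"

lemma trans_prob_nonneg: "trans_prob t x y \<ge> 0"
  by (simp add: trans_prob_def)

lemma sum_trans_prob:
  assumes "t \<ge> 0"
  shows "(\<Sum>y\<in>UNIV. trans_prob t x y) = 1"
proof -
  note [measurable] = measurable_position[OF assms]
  have "(\<Sum>y\<in>UNIV. trans_prob t x y) = measure (P x) (\<Union>y. {\<omega> \<in> space (P x). X t \<omega> = y})"
    unfolding trans_prob_def
    by (rule finite_measure_finite_Union[symmetric]) (auto simp: disjoint_family_on_def)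
  also have "(\<Union>y. {\<omega> \<in> space (P x). X t \<omega> = y}) = space (P x)"
    by auto
  finally show ?thesis
    by (simp add: prob_space)
qed

lemma one_minus_trans_prob:
  assumes "t \<ge> 0"
  shows "1 - trans_prob t x x = (\<Sum>y\<in>UNIV - {x}. trans_prob t x y)"
  using sum_trans_prob[OF assms, of x] by (simp add: sum.remove[of UNIV x])

end

section \<open>First passage probabilities of the skeleton chain\<close>

locale markov_skeleton = finite_markov_process P X
  for P :: "'e::finite \<Rightarrow> 'w measure" and X :: "real \<Rightarrow> 'w \<Rightarrow> 'e" +
  fixes \<delta> :: real and A B :: "'e set"
  assumes mesh: "\<delta> \<ge> 0" and disj: "A \<inter> B = {}"
begin

definition Y :: "nat \<Rightarrow> 'w \<Rightarrow> 'e" where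
  "Y i = X (real i * \<delta>)"

abbreviation p where "p \<equiv> trans_prob \<delta>"

lemma measurable_Y [measurable]: "Y i \<in> measurable (P x) (count_space UNIV)"
  using mesh by (simp add: Y_def measurable_position)

lemma AE_start_Y: "AE \<omega> in P x. Y 0 \<omega> = x"
  using AE_start by (simp add: Y_def)

lemma prob_cylinder:
  "\<P>(\<omega> in P x. \<forall>i\<le>n. Y i \<omega> = z i) = of_bool (z 0 = x) * (\<Prod>i<n. p (z i) (z (Suc i)))"
proof (induction n)
  case 0
  have "\<P>(\<omega> in P x. Y 0 \<omega> = z 0) = measure (P x) (if z 0 = x then space (P x) else {})"
    by (rule finite_measure_eq_AE) (use AE_start_Y[of x] in auto)
  then show ?case
    by (simp add: prob_space)
next
  case (Suc n)
  have "\<P>(\<omega> in P x. \<forall>i\<le>Suc n. X (real i * \<delta>) \<omega> = z i) =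
      \<P>(\<omega> in P x. \<forall>i\<le>n. X (real i * \<delta>) \<omega> = z i) *
      \<P>(\<omega> in P (z n). X (real (Suc n) * \<delta> - real n * \<delta>) \<omega> = z (Suc n))"
    using markov_process mesh unfolding markov_process_def
    by (elim conjE) (erule allE[of _ x], erule allE[of _ n], erule allE[of _ "\<lambda>i. real i * \<delta>"],
        erule allE[of _ z], simp add: mult_right_mono)
  moreover have "real (Suc n) * \<delta> - real n * \<delta> = \<delta>"
    by (simp add: algebra_simps)
  ultimately show ?case
    using Suc.IH unfolding Y_def by (simp add: trans_prob_def)
qed

text \<open>The probability that the skeleton started at \<open>y\<close> first enters
  \<open>A \<union> B\<close> at step \<open>m\<close>, and does so in \<open>B\<close>; see
  \<open>prob_hit\<close>.\<close>

primrec hit :: "nat \<Rightarrow> 'e \<Rightarrow> real" where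
  "hit 0 y = of_bool (y \<in> B)"
| "hit (Suc m) y = of_bool (y \<notin> A \<union> B) * (\<Sum>w\<in>UNIV. p y w * hit m w)"

text \<open>Induction on \<open>m\<close>, splitting by the next value \<open>w\<close>, which
  lengthens the cylinder by one coordinate. Carrying the cylinder along replaces a shift of paths,
  as the sample space is arbitrary.\<close>

lemma prob_cylinder_hit:
  "\<P>(\<omega> in P x. (\<forall>i\<le>n. Y i \<omega> = z i) \<and> (\<forall>i<m. Y (n + i) \<omega> \<notin> A \<union> B) \<and> Y (n + m) \<omega> \<in> B) =
    of_bool (z 0 = x) * (\<Prod>i<n. p (z i) (z (Suc i))) * hit m (z n)"
proof (induction m arbitrary: n z)
  case 0
  have "{\<omega> \<in> space (P x). (\<forall>i\<le>n. Y i \<omega> = z i) \<and> (\<forall>i<0. Y (n + i) \<omega> \<notin> A \<union> B) \<and> Y (n + 0) \<omega> \<in> B} =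
      (if z n \<in> B then {\<omega> \<in> space (P x). \<forall>i\<le>n. Y i \<omega> = z i} else {})"
    by auto
  then show ?case
    by (simp add: prob_cylinder)
next
  case (Suc m)
  show ?case
  proof (cases "z n \<in> A \<union> B")
    case True
    then have "{\<omega> \<in> space (P x). (\<forall>i\<le>n. Y i \<omega> = z i) \<and> (\<forall>i<Suc m. Y (n + i) \<omega> \<notin> A \<union> B) \<and>
        Y (n + Suc m) \<omega> \<in> B} = {}"
      by force
    with True show ?thesis
      by (simp only: hit.simps) simp
  next
    case False
    let ?F = "\<lambda>w. {\<omega> \<in> space (P x). (\<forall>i\<le>Suc n. Y i \<omega> = (z(Suc n := w)) i) \<and>
        (\<forall>i<m. Y (Suc n + i) \<omega> \<notin> A \<union> B) \<and> Y (Suc n + m) \<omega> \<in> B}"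
    have "{\<omega> \<in> space (P x). (\<forall>i\<le>n. Y i \<omega> = z i) \<and> (\<forall>i<Suc m. Y (n + i) \<omega> \<notin> A \<union> B) \<and>
        Y (n + Suc m) \<omega> \<in> B} = (\<Union>w. ?F w)"
    proof -
      have "(\<forall>i\<le>Suc n. f i = (z(Suc n := w)) i) \<longleftrightarrow> (\<forall>i\<le>n. f i = z i) \<and> f (Suc n) = w" for f w
        unfolding le_Suc_eq by auto
      moreover have "(\<forall>i<Suc m. Y (n + i) \<omega> \<notin> A \<union> B) \<longleftrightarrow>
          Y n \<omega> \<notin> A \<union> B \<and> (\<forall>i<m. Y (Suc n + i) \<omega> \<notin> A \<union> B)" for \<omega>
        unfolding All_less_Suc2 by simp
      ultimately show ?thesis
        using False by auto
    qed
    moreover have "measure (P x) (\<Union>w. ?F w) = (\<Sum>w\<in>UNIV. measure (P x) (?F w))"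
    proof (rule finite_measure_finite_Union)
      show "disjoint_family_on ?F UNIV"
      proof (rule disjoint_family_on_by_label[where g = "Y (Suc n)"])
        fix w \<omega> assume "\<omega> \<in> ?F w"
        then have "Y (Suc n) \<omega> = (z(Suc n := w)) (Suc n)"
          by blast
        then show "Y (Suc n) \<omega> = w"
          by simp
      qed
    qed auto
    moreover have "measure (P x) (?F w) =
        of_bool (z 0 = x) * (\<Prod>i<n. p (z i) (z (Suc i))) * (p (z n) w * hit m w)" for w
    proof -
      have "(\<Prod>i<n. p ((z(Suc n := w)) i) ((z(Suc n := w)) (Suc i))) = (\<Prod>i<n. p (z i) (z (Suc i)))"
        by (rule prod.cong) auto
      then show ?thesis
        unfolding Suc.IH by (simp add: mult_ac)
    qed
    ultimately show ?thesis
      using False by (simp add: sum_distrib_left)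
  qed
qed

lemma prob_hit: "\<P>(\<omega> in P y. (\<forall>i<m. Y i \<omega> \<notin> A \<union> B) \<and> Y m \<omega> \<in> B) = hit m y"
proof -
  have "\<P>(\<omega> in P y. (\<forall>i<m. Y i \<omega> \<notin> A \<union> B) \<and> Y m \<omega> \<in> B) =
      \<P>(\<omega> in P y. (\<forall>i\<le>0. Y i \<omega> = y) \<and> (\<forall>i<m. Y (0 + i) \<omega> \<notin> A \<union> B) \<and> Y (0 + m) \<omega> \<in> B)"
    by (rule finite_measure_eq_AE) (use AE_start_Y[of y] in auto)
  also have "\<dots> = hit m y"
    unfolding prob_cylinder_hit by simp
  finally show ?thesis .
qed

text \<open>Splitting by the first new state \<open>y\<close> leaves \<open>k\<close>
  self-transitions, one jump to \<open>y\<close> and a first passage from \<open>y\<close>.\<close>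

lemma prob_skeleton_exits:
  "\<P>(\<omega> in P x. skeleton_exits (\<lambda>i. Y i \<omega>) B A k m) = p x x ^ k * (\<Sum>y\<in>UNIV - {x}. p x y * hit m y)"
proof -
  define z where "z y i = (if i \<le> k then x else y)" for y i
  let ?F = "\<lambda>y. {\<omega> \<in> space (P x). (\<forall>i\<le>Suc k. Y i \<omega> = z y i) \<and>
      (\<forall>i<m. Y (Suc k + i) \<omega> \<notin> A \<union> B) \<and> Y (Suc k + m) \<omega> \<in> B}"
  have "\<P>(\<omega> in P x. skeleton_exits (\<lambda>i. Y i \<omega>) B A k m) = measure (P x) (\<Union>y\<in>UNIV - {x}. ?F y)"
  proof (rule finite_measure_eq_AE)
    show "AE \<omega> in P x. \<omega> \<in> {\<omega> \<in> space (P x). skeleton_exits (\<lambda>i. Y i \<omega>) B A k m} \<longleftrightarrow>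
        \<omega> \<in> (\<Union>y\<in>UNIV - {x}. ?F y)"
      using AE_start_Y[of x]
    proof eventually_elim
      case (elim \<omega>)
      have "(\<forall>i\<le>Suc k. Y i \<omega> = z y i) \<longleftrightarrow> (\<forall>i\<le>k. Y i \<omega> = x) \<and> Y (Suc k) \<omega> = y" for y
        unfolding z_def le_Suc_eq by auto
      with elim show ?case
        by (auto simp: skeleton_exits_def)
    qed
  qed (auto simp: skeleton_exits_def)
  also have "\<dots> = (\<Sum>y\<in>UNIV - {x}. measure (P x) (?F y))"
  proof (rule finite_measure_finite_Union)
    show "disjoint_family_on ?F (UNIV - {x})"
    proof (rule disjoint_family_on_by_label[where g = "Y (Suc k)"])
      fix y \<omega> assume "\<omega> \<in> ?F y"
      then have "Y (Suc k) \<omega> = z y (Suc k)"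
        by blast
      then show "Y (Suc k) \<omega> = y"
        by (simp add: z_def)
    qed
  qed auto
  also have "\<dots> = (\<Sum>y\<in>UNIV - {x}. p x x ^ k * (p x y * hit m y))"
  proof (rule sum.cong)
    fix y
    have "(\<Prod>i<k. p (z y i) (z y (Suc i))) = (\<Prod>i<k. p x x)"
      by (rule prod.cong) (auto simp: z_def)
    then show "measure (P x) (?F y) = p x x ^ k * (p x y * hit m y)"
      unfolding prob_cylinder_hit by (simp add: z_def)
  qed simp
  finally show ?thesis
    by (simp add: sum_distrib_left)
qed

text \<open>The discrete counterpart of \<open>1 - V\<close>: one on \<open>B\<close>, zero on
  \<open>A\<close>.\<close>

definition hit_prob :: "'e \<Rightarrow> real" where
  "hit_prob y = \<P>(\<omega> in P y. \<exists>m. (\<forall>i<m. Y i \<omega> \<notin> A \<union> B) \<and> Y m \<omega> \<in> B)"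

lemma hit_sums: "(\<lambda>m. hit m y) sums hit_prob y"
proof -
  let ?F = "\<lambda>m. {\<omega> \<in> space (P y). (\<forall>i<m. Y i \<omega> \<notin> A \<union> B) \<and> Y m \<omega> \<in> B}"
  have "(\<lambda>m. measure (P y) (?F m)) sums measure (P y) (\<Union>m. ?F m)"
  proof (rule finite_measure_UNION)
    show "disjoint_family ?F"
      unfolding disjoint_family_on_def
    proof (intro ballI impI)
      fix m m' :: nat assume "m \<noteq> m'"
      then show "?F m \<inter> ?F m' = {}"
        by (cases m m' rule: linorder_cases) auto
    qed
  qed auto
  moreover have "(\<Union>m. ?F m) = {\<omega> \<in> space (P y). \<exists>m. (\<forall>i<m. Y i \<omega> \<notin> A \<union> B) \<and> Y m \<omega> \<in> B}"
    by auto
  ultimately show ?thesis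
    unfolding prob_hit hit_prob_def by simp
qed

lemma hit_prob_bounds: "0 \<le> hit_prob y" "hit_prob y \<le> 1"
  by (simp_all add: hit_prob_def)

lemma hit_prob_step: "hit_prob y = of_bool (y \<in> B) + of_bool (y \<notin> A \<union> B) * (\<Sum>w\<in>UNIV. p y w * hit_prob w)"
proof -
  have "(\<lambda>m. hit (Suc m) y) sums (of_bool (y \<notin> A \<union> B) * (\<Sum>w\<in>UNIV. p y w * hit_prob w))"
    unfolding hit.simps(2) by (intro sums_mult sums_sum hit_sums)
  then have "(\<lambda>m. hit m y) sums (of_bool (y \<notin> A \<union> B) * (\<Sum>w\<in>UNIV. p y w * hit_prob w) + hit 0 y)"
    by (rule sums_Suc)
  with hit_sums show ?thesis
    by (metis sums_unique2 add.commute hit.simps(1))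
qed

text \<open>The sum over \<open>k\<close> is geometric, but \<open>p x x\<close> may be 1. Comparing
  the series with its shift gives \<open>q = p x x * q + S\<close> for the probability
  \<open>q\<close> and the right-hand side \<open>S\<close>, without division.\<close>

lemma prob_exit_first_step:
  "(1 - p x x) * \<P>(\<omega> in P x. \<exists>k m. skeleton_exits (\<lambda>i. Y i \<omega>) B A k m) =
    (\<Sum>y\<in>UNIV - {x}. p x y * hit_prob y)" (is "_ * ?q = ?S")
proof -
  let ?E = "\<lambda>k m. {\<omega> \<in> space (P x). skeleton_exits (\<lambda>i. Y i \<omega>) B A k m}"
  have meas: "?E k m \<in> sets (P x)" for k m
    unfolding skeleton_exits_def by measurable
  have "measure (P x) (\<Union>m. ?E k m) = p x x ^ k * ?S" for k
  proof -
    have "(\<lambda>m. measure (P x) (?E k m)) sums measure (P x) (\<Union>m. ?E k m)"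
    proof (rule finite_measure_UNION)
      show "disjoint_family (?E k)"
        unfolding disjoint_family_on_def
      proof (intro ballI impI)
        fix m m' :: nat assume "m \<noteq> m'"
        then show "?E k m \<inter> ?E k m' = {}"
          by (cases m m' rule: linorder_cases) (auto simp: skeleton_exits_def)
      qed
    qed (use meas in auto)
    moreover have "(\<lambda>m. measure (P x) (?E k m)) sums (p x x ^ k * ?S)"
      unfolding prob_skeleton_exits by (intro sums_mult sums_sum hit_sums)
    ultimately show ?thesis
      by (rule sums_unique2)
  qed
  moreover have "(\<lambda>k. measure (P x) (\<Union>m. ?E k m)) sums measure (P x) (\<Union>k. \<Union>m. ?E k m)"
  proof (rule finite_measure_UNION)
    have "skeleton_exits v B A k m \<Longrightarrow> skeleton_exits v B A k' m' \<Longrightarrow> k = k'" for v k m k' m'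
      unfolding skeleton_exits_def by (metis linorder_cases Suc_leI)
    then show "disjoint_family (\<lambda>k. \<Union>m. ?E k m)"
      unfolding disjoint_family_on_def by blast
  qed (use meas in auto)
  moreover have "(\<Union>k. \<Union>m. ?E k m) = {\<omega> \<in> space (P x). \<exists>k m. skeleton_exits (\<lambda>i. Y i \<omega>) B A k m}"
    by auto
  ultimately have q: "(\<lambda>k. p x x ^ k * ?S) sums ?q"
    by simp
  then have "(\<lambda>k. p x x ^ Suc k * ?S) sums (p x x * ?q)"
    using sums_mult[OF q, of "p x x"] by (simp add: mult.assoc)
  then have "(\<lambda>k. p x x ^ k * ?S) sums (p x x * ?q + ?S)"
    by (drule_tac sums_Suc) simp
  with q have "?q = p x x * ?q + ?S"
    by (rule sums_unique2)
  then show ?thesis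
    unfolding left_diff_distrib mult_1 by linarith
qed

end

context finite_markov_process
begin

text \<open>The diagonal entries are eliminated through the row sums, because it is the off-diagonal
  ones whose quotients by \<delta> tend to the jump rates.\<close>

lemma skeleton_dirichlet:
  assumes "\<delta> \<ge> 0" and "A \<inter> B = {}"
  obtains h where "\<And>y. 0 \<le> h y \<and> h y \<le> 1" "\<And>y. y \<in> A \<Longrightarrow> h y = 0" "\<And>y. y \<in> B \<Longrightarrow> h y = 1"
    and "\<And>y. y \<notin> A \<union> B \<Longrightarrow> (\<Sum>w\<in>UNIV - {y}. trans_prob \<delta> y w * (h w - h y)) = 0"
    and "\<And>x. (\<Sum>y\<in>UNIV - {x}. trans_prob \<delta> x y) *
      \<P>(\<omega> in P x. \<exists>k m. skeleton_exits (\<lambda>i. X (real i * \<delta>) \<omega>) B A k m) =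
      (\<Sum>y\<in>UNIV - {x}. trans_prob \<delta> x y * h y)"
proof -
  interpret markov_skeleton P X \<delta> A B
    by standard fact+
  show thesis
  proof (rule that[of hit_prob])
    fix y assume "y \<notin> A \<union> B"
    then have "hit_prob y = (\<Sum>w\<in>UNIV. p y w * hit_prob w)"
      using hit_prob_step[of y] by simp
    then have "(\<Sum>w\<in>UNIV. p y w * (hit_prob w - hit_prob y)) = 0"
      using sum_trans_prob[OF \<open>\<delta> \<ge> 0\<close>, of y]
      by (simp add: right_diff_distrib sum_subtractf flip: sum_distrib_right)
    then show "(\<Sum>w\<in>UNIV - {y}. p y w * (hit_prob w - hit_prob y)) = 0"
      by (simp add: sum.remove[of UNIV y])
  next
    fix y assume "y \<in> A"
    then show "hit_prob y = 0"
      using hit_prob_step[of y] disj by auto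
  next
    fix y assume "y \<in> B"
    then show "hit_prob y = 1"
      using hit_prob_step[of y] by simp
  next
    fix x
    show "(\<Sum>y\<in>UNIV - {x}. p x y) *
        \<P>(\<omega> in P x. \<exists>k m. skeleton_exits (\<lambda>i. X (real i * \<delta>) \<omega>) B A k m) =
        (\<Sum>y\<in>UNIV - {x}. p x y * hit_prob y)"
      using prob_exit_first_step[of x] one_minus_trans_prob[OF \<open>\<delta> \<ge> 0\<close>, of x] by (simp add: Y_def)
  qed (use hit_prob_bounds in auto)
qed

end

section \<open>Passage to the limit of vanishing mesh\<close>

lemma bounded_functions_convergent_subseq:
  fixes h :: "nat \<Rightarrow> 'e::finite \<Rightarrow> real"
  assumes "\<And>n y. a \<le> h n y \<and> h n y \<le> b"
  obtains l s where "strict_mono (s :: nat \<Rightarrow> nat)" "\<And>y. (\<lambda>n. h (s n) y) \<longlonglongrightarrow> l y"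
proof -
  have "(\<chi> y. h n y) \<in> cbox (\<chi> y. a) (\<chi> y. b)" for n
    using assms by (simp add: mem_box_cart)
  then obtain l s where "strict_mono (s :: nat \<Rightarrow> nat)"
    and lim: "((\<lambda>n. \<chi> y. h n y) \<circ> s) \<longlonglongrightarrow> (l :: real ^ 'e)"
    using compact_cbox[of "(\<chi> y. a) :: real ^ 'e" "\<chi> y. b"] unfolding compact_eq_seq_compact_metric seq_compact_def
    by metis
  moreover have "(\<lambda>n. h (s n) y) \<longlonglongrightarrow> l $ y" for y
    using tendsto_vec_nth[OF lim, of y] by (simp add: o_def)
  ultimately show thesis
    using that by blast
qed

locale finite_markov_chain = finite_markov_process P X
  for P :: "'e::finite \<Rightarrow> 'w measure" and X :: "real \<Rightarrow> 'w \<Rightarrow> 'e" +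
  fixes r :: "'e \<Rightarrow> 'e \<Rightarrow> real"
  assumes jump_rates: "has_jump_rates P X r"
begin

definition mesh :: "nat \<Rightarrow> real" where
  "mesh n = inverse (real (Suc n))"

lemma mesh_pos: "mesh n > 0"
  by (simp add: mesh_def)

lemma mesh_at_right: "filterlim mesh (at_right 0) sequentially"
  unfolding filterlim_at
  using LIMSEQ_inverse_real_of_nat by (simp add: mesh_def[abs_def] del: of_nat_Suc)

lemma rate_limit: "x \<noteq> y \<Longrightarrow> (\<lambda>n. trans_prob (mesh n) x y / mesh n) \<longlonglongrightarrow> r x y"
  using jump_rates unfolding has_jump_rates_def trans_prob_def
  by (intro filterlim_compose[OF _ mesh_at_right]) blast

lemma rate_nonneg: "x \<noteq> y \<Longrightarrow> r x y \<ge> 0"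
  by (rule LIMSEQ_le_const[OF rate_limit]) (auto intro!: divide_nonneg_pos trans_prob_nonneg mesh_pos)

lemma holding_rate_limit: "(\<lambda>n. (\<Sum>y\<in>UNIV - {x}. trans_prob (mesh n) x y) / mesh n) \<longlonglongrightarrow> holding_rate r x"
  unfolding holding_rate_def sum_divide_distrib by (intro tendsto_sum rate_limit) auto

text \<open>The mesh from which skeleton and path agree depends on the path. Pointwise agreement in
  the limit is enough for the probabilities to converge.\<close>

lemma exit_prob_limit:
  assumes disj: "A \<inter> B = {}"
  shows "(\<lambda>n. \<P>(\<omega> in P x. \<exists>k m. skeleton_exits (\<lambda>i. X (real i * mesh n) \<omega>) B A k m))
    \<longlonglongrightarrow> \<P>(\<omega> in P x. return_time X A \<omega> > return_time X B \<omega>)"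
proof (rule measure_tendsto_eventually)
  fix n
  have [measurable]: "X (real i * mesh n) \<in> measurable (P x) (count_space UNIV)" for i
    using mesh_pos[of n] by (intro measurable_position) simp
  show "{\<omega> \<in> space (P x). \<exists>k m. skeleton_exits (\<lambda>i. X (real i * mesh n) \<omega>) B A k m} \<in> sets (P x)"
    unfolding skeleton_exits_def by measurable
next
  fix \<omega> assume \<omega>: "\<omega> \<in> space (P x)"
  interpret right_continuous_path "\<lambda>t. X t \<omega>"
    by (rule right_continuous[OF \<omega>])
  have "\<exists>\<epsilon>>0. \<forall>\<delta>. 0 < \<delta> \<and> \<delta> < \<epsilon> \<longrightarrow> ((\<exists>k m. skeleton_exits (\<lambda>i. X (real i * \<delta>) \<omega>) B A k m) \<longleftrightarrow>
      exits_to_avoiding (\<lambda>t. X t \<omega>) B A)"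
    using exits_imp_skeleton[OF _ disj] skeleton_imp_exits[OF _ disj]
    by (cases "exits_to_avoiding (\<lambda>t. X t \<omega>) B A") simp_all
  then have "\<forall>\<^sub>F \<delta> in at_right 0. (\<exists>k m. skeleton_exits (\<lambda>i. X (real i * \<delta>) \<omega>) B A k m) \<longleftrightarrow>
      exits_to_avoiding (\<lambda>t. X t \<omega>) B A"
    unfolding eventually_at_right_field by auto
  then have "\<forall>\<^sub>F n in sequentially. (\<exists>k m. skeleton_exits (\<lambda>i. X (real i * mesh n) \<omega>) B A k m) \<longleftrightarrow>
      exits_to_avoiding (\<lambda>t. X t \<omega>) B A"
    using mesh_at_right unfolding filterlim_iff by blast
  then show "\<forall>\<^sub>F n in sequentially.
      \<omega> \<in> {\<omega> \<in> space (P x). \<exists>k m. skeleton_exits (\<lambda>i. X (real i * mesh n) \<omega>) B A k m} \<longleftrightarrow>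
      \<omega> \<in> {\<omega> \<in> space (P x). return_time X A \<omega> > return_time X B \<omega>}"
    using \<omega> return_time_less_iff[where X = X and \<omega> = \<omega>, OF right_continuous[OF \<omega>] disj] by simp
qed auto

text \<open>Only some solution \<open>h\<close> is wanted, so a subsequential limit suffices. The
  exit probabilities converge along the whole sequence, hence along the chosen subsequence
  too.\<close>

lemma return_prob_dirichlet:
  assumes disj: "A \<inter> B = {}"
  obtains h where "\<And>y. y \<in> A \<Longrightarrow> h y = 0" "\<And>y. y \<in> B \<Longrightarrow> h y = 1"
    and "\<And>y. y \<notin> A \<union> B \<Longrightarrow> (\<Sum>w\<in>UNIV - {y}. r y w * (h w - h y)) = 0"
    and "\<And>x. holding_rate r x * \<P>(\<omega> in P x. return_time X A \<omega> > return_time X B \<omega>) =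
      (\<Sum>y\<in>UNIV - {x}. r x y * h y)"
proof -
  let ?q = "\<lambda>n x. \<P>(\<omega> in P x. \<exists>k m. skeleton_exits (\<lambda>i. X (real i * mesh n) \<omega>) B A k m)"
  have ex: "\<forall>n. \<exists>h. (\<forall>y. 0 \<le> h y \<and> h y \<le> 1) \<and> (\<forall>y\<in>A. h y = 0) \<and> (\<forall>y\<in>B. h y = 1) \<and>
      (\<forall>y. y \<notin> A \<union> B \<longrightarrow> (\<Sum>w\<in>UNIV - {y}. trans_prob (mesh n) y w * (h w - h y)) = 0) \<and>
      (\<forall>x. (\<Sum>y\<in>UNIV - {x}. trans_prob (mesh n) x y) * ?q n x = (\<Sum>y\<in>UNIV - {x}. trans_prob (mesh n) x y * h y))"
    (is "\<forall>n. \<exists>h. ?R n h")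
  proof
    fix n
    show "\<exists>h. ?R n h"
      by (rule skeleton_dirichlet[OF less_imp_le[OF mesh_pos] disj, of n]) blast
  qed
  obtain h where "\<forall>n. ?R n (h n)"
    using choice[OF ex] by (rule exE)
  then have h: "?R n (h n)" for n
    by (rule spec)
  \<comment> \<open>Values in the unit interval and finitely many states: compactness gives one
    subsequence that serves all states.\<close>
  obtain l s where s: "strict_mono (s :: nat \<Rightarrow> nat)" and lim: "\<And>y. (\<lambda>n. h (s n) y) \<longlonglongrightarrow> l y"
    by (rule bounded_functions_convergent_subseq[of 0 h 1]) (use h in blast)+
  have rate: "(\<lambda>n. trans_prob (mesh (s n)) x y / mesh (s n)) \<longlonglongrightarrow> r x y" if "x \<noteq> y" for x y
    using LIMSEQ_subseq_LIMSEQ[OF rate_limit[OF that] s] by (simp add: o_def)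
  show thesis
  proof (rule that[of l])
    fix y assume "y \<in> A"
    then have "h (s n) y = 0" for n
      using h by blast
    then show "l y = 0"
      using lim[of y] by (simp add: LIMSEQ_const_iff)
  next
    fix y assume "y \<in> B"
    then have "h (s n) y = 1" for n
      using h by blast
    then show "l y = 1"
      using lim[of y] by (simp add: LIMSEQ_const_iff)
  next
    fix y assume y: "y \<notin> A \<union> B"
    have "(\<lambda>n. \<Sum>w\<in>UNIV - {y}. trans_prob (mesh (s n)) y w / mesh (s n) * (h (s n) w - h (s n) y))
        \<longlonglongrightarrow> (\<Sum>w\<in>UNIV - {y}. r y w * (l w - l y))"
      by (intro tendsto_sum tendsto_mult tendsto_diff rate lim) auto
    moreover have "(\<Sum>w\<in>UNIV - {y}. trans_prob (mesh (s n)) y w / mesh (s n) * (h (s n) w - h (s n) y)) = 0" for n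
    proof -
      have "(\<Sum>w\<in>UNIV - {y}. trans_prob (mesh (s n)) y w * (h (s n) w - h (s n) y)) / mesh (s n) = 0"
        using h[of "s n"] y by simp
      then show ?thesis
        unfolding sum_divide_distrib by simp
    qed
    ultimately show "(\<Sum>w\<in>UNIV - {y}. r y w * (l w - l y)) = 0"
      by (simp add: LIMSEQ_const_iff)
  next
    fix x
    have "(\<lambda>n. \<Sum>y\<in>UNIV - {x}. trans_prob (mesh (s n)) x y / mesh (s n) * h (s n) y)
        \<longlonglongrightarrow> (\<Sum>y\<in>UNIV - {x}. r x y * l y)"
      by (intro tendsto_sum tendsto_mult rate lim) auto
    moreover have "(\<Sum>y\<in>UNIV - {x}. trans_prob (mesh (s n)) x y / mesh (s n) * h (s n) y) =
        (\<Sum>y\<in>UNIV - {x}. trans_prob (mesh (s n)) x y) / mesh (s n) * ?q (s n) x" for n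
    proof -
      have "(\<Sum>y\<in>UNIV - {x}. trans_prob (mesh (s n)) x y / mesh (s n) * h (s n) y) =
          (\<Sum>y\<in>UNIV - {x}. trans_prob (mesh (s n)) x y * h (s n) y) / mesh (s n)"
        unfolding sum_divide_distrib by simp
      also have "\<dots> = (\<Sum>y\<in>UNIV - {x}. trans_prob (mesh (s n)) x y) * ?q (s n) x / mesh (s n)"
        using h[of "s n"] by presburger
      finally show ?thesis
        by simp
    qed
    ultimately have "(\<lambda>n. (\<Sum>y\<in>UNIV - {x}. trans_prob (mesh (s n)) x y) / mesh (s n) * ?q (s n) x)
        \<longlonglongrightarrow> (\<Sum>y\<in>UNIV - {x}. r x y * l y)"
      by simp
    moreover have "(\<lambda>n. (\<Sum>y\<in>UNIV - {x}. trans_prob (mesh (s n)) x y) / mesh (s n) * ?q (s n) x)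
        \<longlonglongrightarrow> holding_rate r x * \<P>(\<omega> in P x. return_time X A \<omega> > return_time X B \<omega>)"
      using LIMSEQ_subseq_LIMSEQ[OF tendsto_mult[OF holding_rate_limit exit_prob_limit[OF disj]] s]
      unfolding o_def .
    ultimately show "holding_rate r x * \<P>(\<omega> in P x. return_time X A \<omega> > return_time X B \<omega>) =
        (\<Sum>y\<in>UNIV - {x}. r x y * l y)"
      by (rule LIMSEQ_unique[rotated])
  qed
qed

text \<open>Invariance at time \<open>mesh n\<close>, with the diagonal term moved across by the row
  sums, is divided by the mesh and passed to the limit.\<close>

lemma stationary_balance:
  assumes stat: "stationary_measure P X \<mu>"
  shows "(\<Sum>x\<in>UNIV - {y}. \<mu> x * r x y) = \<mu> y * holding_rate r y"
proof -
  have eq: "(\<Sum>x\<in>UNIV - {y}. \<mu> x * (trans_prob (mesh n) x y / mesh n)) =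
      \<mu> y * ((\<Sum>x\<in>UNIV - {y}. trans_prob (mesh n) y x) / mesh n)" for n
  proof -
    have "(\<Sum>x\<in>UNIV. \<mu> x * trans_prob (mesh n) x y) = \<mu> y"
      using stat mesh_pos[of n] by (simp add: stationary_measure_def trans_prob_def)
    then have "(\<Sum>x\<in>UNIV - {y}. \<mu> x * trans_prob (mesh n) x y) = \<mu> y * (1 - trans_prob (mesh n) y y)"
      by (simp add: sum.remove[of UNIV y] algebra_simps)
    then show ?thesis
      using one_minus_trans_prob[of "mesh n" y] mesh_pos[of n]
      by (simp flip: sum_divide_distrib)
  qed
  have "(\<lambda>n. \<Sum>x\<in>UNIV - {y}. \<mu> x * (trans_prob (mesh n) x y / mesh n))
      \<longlonglongrightarrow> (\<Sum>x\<in>UNIV - {y}. \<mu> x * r x y)"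
    by (intro tendsto_sum tendsto_mult tendsto_const rate_limit) auto
  moreover have "(\<lambda>n. \<mu> y * ((\<Sum>x\<in>UNIV - {y}. trans_prob (mesh n) y x) / mesh n))
      \<longlonglongrightarrow> \<mu> y * holding_rate r y"
    by (intro tendsto_mult tendsto_const holding_rate_limit)
  ultimately show ?thesis
    unfolding eq by (rule LIMSEQ_unique)
qed

text \<open>Positivity spreads along edges: a positive inflow into \<open>v\<close> equals
  \<open>\<mu> v * holding_rate r v\<close>, which excludes \<open>\<mu> v = 0\<close>.\<close>

lemma stationary_pos:
  assumes stat: "stationary_measure P X \<mu>" and irr: "irreducible_rates r"
  shows "\<mu> y > 0"
proof -
  have nonneg: "\<mu> x \<ge> 0" for x
    using stat by (simp add: stationary_measure_def)
  obtain x0 where "\<mu> x0 > 0"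
    using stat nonneg by (metis stationary_measure_def order_le_less)
  have "(x0, y) \<in> {(u, v). u \<noteq> v \<and> r u v > 0}\<^sup>*"
    using irr by (simp add: irreducible_rates_def)
  then show ?thesis
  proof (induction rule: rtrancl_induct)
    case base
    show ?case by fact
  next
    case (step u v)
    then have "0 < \<mu> u * r u v"
      by simp
    also have "\<dots> \<le> (\<Sum>x\<in>UNIV - {v}. \<mu> x * r x v)"
      using step.hyps nonneg rate_nonneg by (intro member_le_sum) auto
    finally show ?case
      using nonneg[of v] by (auto simp: stationary_balance[OF stat] zero_less_mult_iff)
  qed
qed

lemma circulation_conductance:
  assumes stat: "stationary_measure P X \<mu>" and irr: "irreducible_rates r"
  shows "circulation (off_diag (conductance r \<mu>))"
proof
  note pos = stationary_pos[OF assms]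
  fix x y
  show "off_diag (conductance r \<mu>) x y \<ge> 0"
    using pos[of x] rate_nonneg[of x y] by (simp add: off_diag_def conductance_def)
  have "(\<Sum>y\<in>UNIV. off_diag (conductance r \<mu>) x y) = (\<Sum>y\<in>UNIV - {x}. \<mu> x * r x y)"
    by (rule sum.mono_neutral_cong_right) (auto simp: off_diag_def conductance_def)
  also have "\<dots> = (\<Sum>y\<in>UNIV - {x}. \<mu> y * r y x)"
    unfolding stationary_balance[OF stat] by (simp add: holding_rate_def sum_distrib_left)
  also have "\<dots> = (\<Sum>y\<in>UNIV. off_diag (conductance r \<mu>) y x)"
    by (rule sum.mono_neutral_cong_left) (auto simp: off_diag_def conductance_def)
  finally show "(\<Sum>y\<in>UNIV. off_diag (conductance r \<mu>) x y) = (\<Sum>y\<in>UNIV. off_diag (conductance r \<mu>) y x)" .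
  \<comment> \<open>Since \<mu> is positive, conductances and rates have the same graph, so
    irreducibility carries over.\<close>
  have "{(u, v). off_diag (conductance r \<mu>) u v > 0} = {(u, v). u \<noteq> v \<and> r u v > 0}"
    using pos by (auto simp: off_diag_def conductance_def zero_less_mult_iff not_less order.strict_implies_order
        split: if_splits dest: less_imp_not_less)
  then show "(x, y) \<in> {(u, v). off_diag (conductance r \<mu>) u v > 0}\<^sup>*"
    using irr by (simp add: irreducible_rates_def)
qed

end

section \<open>The capacity as a boundary sum of the Laplacian of the potential\<close>

lemma laplacian_off_diag:
  "laplacian (off_diag (conductance r \<mu>)) g x = \<mu> x * (\<Sum>y\<in>UNIV - {x}. r x y * (g x - g y))"
  unfolding laplacian_def sum_distrib_left
  by (rule sum.mono_neutral_cong_right) (auto simp: off_diag_def conductance_def)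

theorem theorem2p7:
  fixes P :: "'e::finite \<Rightarrow> 'w measure"
    and X :: "real \<Rightarrow> 'w \<Rightarrow> 'e"
    and r :: "'e \<Rightarrow> 'e \<Rightarrow> real"
    and \<mu> :: "'e \<Rightarrow> real"
    and A B :: "'e set"
  assumes "markov_process P X"
    and "has_jump_rates P X r"
    and "irreducible_rates r"
    and "stationary_measure P X \<mu>"
    and "A \<inter> B = {}" and "A \<noteq> {}" and "B \<noteq> {}"
  shows "capacity P X r \<mu> A B =
    (INF f\<in>{f :: 'e \<Rightarrow> real. (\<forall>x\<in>A. f x = 1) \<and> (\<forall>x\<in>B. f x = 0)}.
     INF \<phi>\<in>{\<phi> \<in> flows r \<mu>.
              (\<forall>x. x \<notin> A \<union> B \<longrightarrow> flow_div r \<mu> \<phi> x = 0) \<and>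
              (\<Sum>a\<in>A. flow_div r \<mu> \<phi> a) = 0 \<and>
              (\<Sum>b\<in>B. flow_div r \<mu> \<phi> b) = 0}.
       (flow_norm r \<mu> (Phi_flow r \<mu> f - \<phi>))\<^sup>2)"
proof -
  interpret finite_markov_chain P X r
    by unfold_locales fact+
  interpret flow_circulation r \<mu>
    by (rule flow_circulation.intro, rule circulation_conductance[OF assms(4,3)])
  obtain h where h: "\<And>y. y \<in> A \<Longrightarrow> h y = 0" "\<And>y. y \<in> B \<Longrightarrow> h y = 1"
    "\<And>y. y \<notin> A \<union> B \<Longrightarrow> (\<Sum>w\<in>UNIV - {y}. r y w * (h w - h y)) = 0"
    "\<And>x. holding_rate r x * \<P>(\<omega> in P x. return_time X A \<omega> > return_time X B \<omega>) =
      (\<Sum>y\<in>UNIV - {x}. r x y * h y)"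
    by (rule return_prob_dirichlet[OF assms(5)]) blast
  \<comment> \<open>\<open>h\<close> favours \<open>B\<close>; the complement has the boundary
    values 1 on \<open>A\<close> and 0 on \<open>B\<close>.\<close>
  define V where "V x = 1 - h x" for x
  have lap: "laplacian (off_diag (conductance r \<mu>)) V x = \<mu> x * (\<Sum>y\<in>UNIV - {x}. r x y * (h y - h x))" for x
    unfolding laplacian_off_diag V_def by simp
  have "capacity P X r \<mu> A B = (\<Sum>x\<in>A. laplacian (off_diag (conductance r \<mu>)) V x)"
    unfolding capacity_def
  proof (rule sum.cong)
    fix x assume "x \<in> A"
    then show "\<mu> x * holding_rate r x * \<P>(\<omega> in P x. return_time X A \<omega> > return_time X B \<omega>) =
        laplacian (off_diag (conductance r \<mu>)) V x"
      \<comment> \<open>On \<open>A\<close> the value \<open>h x\<close> is zero, so the differences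
        in the Laplacian reduce to the sum in the first-step identity.\<close>
      unfolding lap mult.assoc h(4) by (simp add: h(1))
  qed simp
  then show ?thesis
    by (simp only:) (rule dirichlet_principle[OF assms(5,6)], simp_all add: lap V_def h)
qed

end
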